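(* Let $\alpha\in\mathbb{R}$ and let $\mathrm{Pf}\,x^{\alpha}$ be the tempered distribution generated (via Hadamard finite part) by the function $x\mapsto x^{\alpha}$. Then $$\mathscr{F}\,\mathrm{Pf}\,x^{\alpha}=\begin{cases} 2\pi \,i^{\alpha}\,\mathscr{D}^{\alpha}\delta&\text{if } \alpha\in\{0,1,2,3,\dots\},\\ T_{g}&\text{if } \alpha\in\{-1,-2,-3,\dots\},\\ \Gamma(\alpha+1)\left(\mathrm{e}^{-i\pi\alpha}\,\mathrm{Pf}\,\dfrac{1}{(-ix)^{\alpha+1}}+\mathrm{Pf}\,\dfrac{1}{(ix)^{\alpha+1}}\right)&\text{if } \alpha\in\mathbb{R}\setminus\mathbb{Z}, \end{cases}$$ where $T_g$ is the distribution generated by $$g(x)=\pi\frac{i^{\alpha}\,x^{-\alpha-1}}{(-\alpha-1)!}\,\mathrm{sgn}(x).$$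
   Context: $\mathscr{S}'(\mathbb{R})$ is the space of tempered distributions; the Fourier transform is $\mathscr{F}T[\varphi]:=T[\hat\varphi]$ with $\hat{\varphi}(k)=\int_{\mathbb{R}}\varphi(x)e^{-ikx}\,dx$. For a locally integrable, polynomially bounded $f$, $T_f[\varphi]=\int f\varphi$. For $n\in\mathbb{N}_0$, $\mathscr{D}^n$ is the $n$-th distributional derivative and $\delta[\varphi]=\varphi(0)$. For a function $f$ singular only at $0$, $\mathrm{Pf}\,f$ is the distribution $\varphi\mapsto$ finite part (constant term after discarding terms divergent as $\epsilon\to0^+$) of $\int_{|x|>\epsilon}f\varphi\,dx$. Complex powers use the branch $\log(re^{i\theta})=\log r+i\theta$, $r>0$, $-\pi\le\theta<\pi$, with $z^\beta:=e^{\beta\log z}$ (so $i^\beta=e^{i\pi\beta/2}$, $(-1)^\beta=e^{-i\pi\beta}$). $\Gamma$ is the Gamma function. *)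

theory Defs
  imports "HOL-Analysis.Analysis"
begin

text \<open>Test functions and distributions are complex valued functions of a real variable.
  A (tempered) distribution is modelled as a functional on test functions; equality of
  distributions is equality of their values on all Schwartz functions.\<close>

type_synonym test = "real \<Rightarrow> complex"
type_synonym distr = "(real \<Rightarrow> complex) \<Rightarrow> complex"

definition vderiv :: "(real \<Rightarrow> complex) \<Rightarrow> real \<Rightarrow> complex" where
  "vderiv f = (\<lambda>x. vector_derivative f (at x))"

definition smooth :: "(real \<Rightarrow> complex) \<Rightarrow> bool" where
  "smooth f \<longleftrightarrow> (\<forall>n x. ((vderiv ^^ n) f has_vector_derivative (vderiv ^^ Suc n) f x) (at x))"

definition schwartz :: "(real \<Rightarrow> complex) \<Rightarrow> bool" where
  "schwartz f \<longleftrightarrow> smooth f \<and>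
     (\<forall>k n. bounded (range (\<lambda>x. complex_of_real x ^ k * (vderiv ^^ n) f x)))"

definition fourier :: "(real \<Rightarrow> complex) \<Rightarrow> real \<Rightarrow> complex" where
  "fourier \<phi> = (\<lambda>k. integral UNIV (\<lambda>x. \<phi> x * exp (- \<i> * complex_of_real (k * x))))"

definition fourier_dist :: "distr \<Rightarrow> distr" where
  "fourier_dist T = (\<lambda>\<phi>. T (fourier \<phi>))"

definition regular_dist :: "(real \<Rightarrow> complex) \<Rightarrow> distr" where
  "regular_dist f = (\<lambda>\<phi>. integral UNIV (\<lambda>x. f x * \<phi> x))"

definition dist_deriv :: "nat \<Rightarrow> distr \<Rightarrow> distr" where
  "dist_deriv n T = (\<lambda>\<phi>. (-1) ^ n * T ((vderiv ^^ n) \<phi>))"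

definition dirac :: distr where
  "dirac = (\<lambda>\<phi>. \<phi> 0)"

text \<open>Hadamard finite part of a function \<open>I(\<epsilon>)\<close> as \<open>\<epsilon> \<rightarrow> 0\<^sup>+\<close>: the constant term left after
  subtracting finitely many divergent terms \<open>a \<epsilon>^{-\<beta>} (log (1/\<epsilon>))^m\<close>
  (with \<open>\<beta> > 0\<close>, or \<open>\<beta> = 0\<close> and \<open>m \<ge> 1\<close>).\<close>
definition has_finite_part :: "(real \<Rightarrow> complex) \<Rightarrow> complex \<Rightarrow> bool" where
  "has_finite_part I c \<longleftrightarrow>
     (\<exists>(N::nat) (a::nat \<Rightarrow> complex) (\<beta>::nat \<Rightarrow> real) (m::nat \<Rightarrow> nat).
        (\<forall>j<N. \<beta> j > 0 \<or> (\<beta> j = 0 \<and> m j > 0)) \<and>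
        ((\<lambda>\<epsilon>. I \<epsilon> - (\<Sum>j<N. a j * complex_of_real (\<epsilon> powr (- \<beta> j) * ln (1 / \<epsilon>) ^ m j)))
           \<longlongrightarrow> c) (at_right 0))"

definition finite_part :: "(real \<Rightarrow> complex) \<Rightarrow> complex" where
  "finite_part I = (THE c. has_finite_part I c)"

definition Pf :: "(real \<Rightarrow> complex) \<Rightarrow> distr" where
  "Pf f = (\<lambda>\<phi>. finite_part (\<lambda>\<epsilon>. integral {x. \<epsilon> < \<bar>x\<bar>} (\<lambda>x. f x * \<phi> x)))"

text \<open>Complex logarithm with branch \<open>-\<pi> \<le> \<theta> < \<pi>\<close> and the corresponding complex power.\<close>
definition plog :: "complex \<Rightarrow> complex" where
  "plog z = (if Im z = 0 \<and> Re z < 0 then complex_of_real (ln (cmod z)) - \<i> * complex_of_real pi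
             else Ln z)"

definition pcpow :: "complex \<Rightarrow> complex \<Rightarrow> complex" where
  "pcpow z \<beta> = (if z = 0 then 0 else exp (\<beta> * plog z))"

end

theory Submission
  imports Defs "HOL-Probability.Sinc_Integral" "HOL-Probability.Characteristic_Functions"
    "HOL-Real_Asymp.Real_Asymp" "HOL-Complex_Analysis.Cauchy_Integral_Theorem"
begin

text \<open>The function \<open>x\<^sup>\<alpha>\<close> is a combination of \<open>x\<^sub>+\<^sup>\<alpha>\<close> and \<open>x\<^sub>-\<^sup>\<alpha>\<close>. Two operations move the exponent by one on both
  sides of the formula at once: integration by parts in the finite part (the boundary terms contribute no
  constant term, since \<open>\<alpha>\<close> is not an integer or since the two sides cancel by parity), and multiplication
  by \<open>x\<close>; the Fourier transform exchanges them. Hence it suffices to treat \<open>-1 < \<alpha> < 0\<close> and \<open>\<alpha> = -1\<close>. For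
  \<open>-1 < \<alpha> < 0\<close> everything is locally integrable: insert \<open>e\<^bsup>-sk\<^esup>\<close>, use the duality \<open>\<integral>f \<F>g = \<integral>\<F>f g\<close> with
  \<open>\<integral>\<^sub>0\<^sup>\<infinity> k\<^sup>\<alpha> e\<^bsup>-(s+ix)k\<^esup> dk = \<Gamma>(\<alpha>+1) (s+ix)\<^bsup>-\<alpha>-1\<^esup>\<close>, and let \<open>s \<rightarrow> 0\<close>. For \<open>\<alpha> = -1\<close> use the same duality with \<open>1/k\<close>
  cut off to \<open>\<epsilon> < |k| < R\<close>, whose transform is a difference of sine integrals. The case \<open>\<alpha> = 0\<close>, i.e. Fourier
  inversion at the origin, is the shift of the case \<open>\<alpha> = -1\<close>.\<close>

section \<open>Uniqueness and linearity of the finite part\<close>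

text \<open>Apart from the delta, every distribution involved is a homogeneous function A x_+^a + B
  x_-^a, so the branch of the complex power enters only through the pair (A, B); for x^\<alpha> it
  is (1, e^(-i pi \<alpha>)). Differentiation and multiplication by x both turn B into -B and change
  the test function, so the shift closes up only when a formula is asserted for all Schwartz
  functions and for a family of pairs stable under this sign change. The obstacle is that
  \<open>finite_part\<close> is a definite description: its value is known only after existence and
  uniqueness of the constant term. Uniqueness amounts to the independence of the scales eps^(-beta)
  log(1/eps)^m. Existence is carried along: each transform rule speaks of one number c that is a
  finite part on both sides. Integration by parts from b to b - 1 divides by b, so exponent -1
  cannot be reached from 0 and has to be computed directly. Past it, at b = -n, the degree-n Taylor
  term of the boundary expression is a constant, killed exactly when A + B (-1)^n = 0. A genuine
  integer power satisfies this, a single half-line does not; hence the integer case keeps a fixed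
  pair where the non-integer case allows all pairs.\<close>

definition divergent_scale :: "real \<times> nat \<Rightarrow> real \<Rightarrow> complex" where
  "divergent_scale p \<epsilon> = complex_of_real (\<epsilon> powr (- fst p) * ln (1 / \<epsilon>) ^ snd p)"

text \<open>With L = log(1/eps) the quotient is eps^(\<beta> - \<beta>') L^(k - m). A positive power
  of eps beats every power of L, and at equal exponents the surplus logarithms in the denominator
  suffice. Growth is thus ordered lexicographically.\<close>

lemma divergent_scale_ratio_tendsto_0:
  assumes "\<beta>' < \<beta> \<or> \<beta>' = \<beta> \<and> k < m"
  shows "((\<lambda>\<epsilon>. divergent_scale (\<beta>', k) \<epsilon> / divergent_scale (\<beta>, m) \<epsilon>) \<longlongrightarrow> 0) (at_right 0)"
proof -
  have "((\<lambda>\<epsilon>::real. (\<epsilon> powr (- \<beta>') * ln (1 / \<epsilon>) ^ k) / (\<epsilon> powr (- \<beta>) * ln (1 / \<epsilon>) ^ m))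
      \<longlongrightarrow> 0) (at_right 0)"
    using assms
  proof
    assume "\<beta>' < \<beta>"
    then have "((\<lambda>\<epsilon>::real. \<epsilon> powr (\<beta> - \<beta>') * ln (1 / \<epsilon>) ^ k) \<longlongrightarrow> 0) (at_right 0)"
      by real_asymp
    moreover have "((\<lambda>\<epsilon>::real. 1 / ln (1 / \<epsilon>)) \<longlongrightarrow> 0) (at_right 0)"
      by real_asymp
    ultimately have "((\<lambda>\<epsilon>::real. \<epsilon> powr (\<beta> - \<beta>') * ln (1 / \<epsilon>) ^ k * (1 / ln (1 / \<epsilon>)) ^ m)
        \<longlongrightarrow> 0 * 0 ^ m) (at_right 0)"
      by (intro tendsto_mult tendsto_power)
    moreover have "eventually (\<lambda>\<epsilon>. \<epsilon> powr (\<beta> - \<beta>') * ln (1 / \<epsilon>) ^ k * (1 / ln (1 / \<epsilon>)) ^ m =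
       (\<epsilon> powr (- \<beta>') * ln (1 / \<epsilon>) ^ k) / (\<epsilon> powr (- \<beta>) * ln (1 / \<epsilon>) ^ m)) (at_right (0::real))"
      unfolding eventually_at_right_field
      by (rule exI[of _ 1]) (auto simp: powr_diff powr_minus power_one_over field_simps)
    ultimately show ?thesis by (auto elim: Lim_transform_eventually)
  next
    assume *: "\<beta>' = \<beta> \<and> k < m"
    then obtain j where j: "m = k + Suc j" by (auto simp: less_iff_Suc_add)
    have "((\<lambda>\<epsilon>::real. 1 / ln (1 / \<epsilon>)) \<longlongrightarrow> 0) (at_right 0)"
      by real_asymp
    from tendsto_power[OF this, of "Suc j"]
    have "((\<lambda>\<epsilon>::real. 1 / ln (1 / \<epsilon>) ^ Suc j) \<longlongrightarrow> 0) (at_right 0)"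
      by (simp add: power_one_over)
    moreover have "eventually (\<lambda>\<epsilon>. 1 / ln (1 / \<epsilon>) ^ Suc j =
       (\<epsilon> powr (- \<beta>') * ln (1 / \<epsilon>) ^ k) / (\<epsilon> powr (- \<beta>) * ln (1 / \<epsilon>) ^ m)) (at_right (0::real))"
      unfolding eventually_at_right_field
      by (rule exI[of _ 1]) (use * j in \<open>auto simp: power_add\<close>)
    ultimately show ?thesis by (rule Lim_transform_eventually)
  qed
  from tendsto_of_real[OF this, where ?'a=complex] show ?thesis
    by (simp add: divergent_scale_def)
qed

text \<open>Divide by the lexicographically largest scale in \<open>S\<close>: the convergent sum
  then tends to 0, while all summands but the leading one vanish in the limit. So the leading
  coefficient is 0, and induction removes the term until the sum is empty.\<close>

lemma divergent_sum_distinct_tendsto_imp_0: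
  assumes "finite S" "\<And>\<beta> m. (\<beta>, m) \<in> S \<Longrightarrow> \<beta> > 0 \<or> \<beta> = 0 \<and> m > 0"
    and "((\<lambda>\<epsilon>. \<Sum>p\<in>S. b p * divergent_scale p \<epsilon>) \<longlongrightarrow> c) (at_right 0)"
  shows "c = 0"
  using assms
proof (induction S rule: finite_psubset_induct)
  case (psubset S)
  show ?case
  proof (cases "S = {}")
    case True
    then show ?thesis using psubset.prems(2) by (simp add: tendsto_const_iff)
  next
    case False
    define \<beta> where "\<beta> = Max (fst ` S)"
    define m where "m = Max {m. (\<beta>, m) \<in> S}"
    have "\<beta> \<in> fst ` S" unfolding \<beta>_def using False psubset.hyps by (intro Max_in) auto
    moreover have fin: "finite {m. (\<beta>, m) \<in> S}"
      using finite_subset[OF _ finite_imageI[OF psubset.hyps(1), of snd], of "{m. (\<beta>, m) \<in> S}"] by force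
    ultimately have p: "(\<beta>, m) \<in> S"
      using Max_in[OF fin] unfolding m_def by fastforce
    have lex: "\<beta>' < \<beta> \<or> \<beta>' = \<beta> \<and> k < m" if "(\<beta>', k) \<in> S - {(\<beta>, m)}" for \<beta>' k
    proof -
      have "\<beta>' \<le> \<beta>" unfolding \<beta>_def using that psubset.hyps by (intro Max_ge) force+
      moreover have "k \<le> m" if "\<beta>' = \<beta>"
        unfolding m_def using that \<open>(\<beta>', k) \<in> _\<close> fin by (intro Max_ge) auto
      ultimately show ?thesis using that by force
    qed
    have nz: "eventually (\<lambda>\<epsilon>. divergent_scale (\<beta>, m) \<epsilon> \<noteq> 0) (at_right 0)"
      unfolding eventually_at_right_field
      by (rule exI[of _ 1]) (auto simp: divergent_scale_def)
    \<comment> \<open>The pair \<open>(0, 0)\<close> has scale 1 for positive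
      \<open>\<epsilon>\<close>; writing the reciprocal of the leading scale as a quotient lets the
      ratio lemma show that it tends to 0.\<close>
    have "((\<lambda>\<epsilon>. (\<Sum>p\<in>S. b p * divergent_scale p \<epsilon>) * (divergent_scale (0, 0) \<epsilon> / divergent_scale (\<beta>, m) \<epsilon>))
        \<longlongrightarrow> c * 0) (at_right 0)"
      using psubset.prems(1)[OF p]
      by (intro tendsto_mult psubset.prems(2) divergent_scale_ratio_tendsto_0) auto
    moreover have "eventually (\<lambda>\<epsilon>. (\<Sum>p\<in>S. b p * divergent_scale p \<epsilon>) * (divergent_scale (0, 0) \<epsilon> / divergent_scale (\<beta>, m) \<epsilon>)
       = b (\<beta>, m) + (\<Sum>p\<in>S - {(\<beta>, m)}. b p * (divergent_scale p \<epsilon> / divergent_scale (\<beta>, m) \<epsilon>))) (at_right 0)"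
      using nz eventually_at_right_less[of 0]
    proof eventually_elim
      case (elim \<epsilon>)
      then have "divergent_scale (0, 0) \<epsilon> = 1" by (simp add: divergent_scale_def)
      then show ?case using elim
        by (simp add: sum.remove[OF psubset.hyps(1) p] sum_divide_distrib add_divide_distrib)
    qed
    ultimately have "((\<lambda>\<epsilon>. b (\<beta>, m) + (\<Sum>p\<in>S - {(\<beta>, m)}. b p * (divergent_scale p \<epsilon> / divergent_scale (\<beta>, m) \<epsilon>)))
        \<longlongrightarrow> 0) (at_right 0)"
      by (auto elim: Lim_transform_eventually)
    moreover have "((\<lambda>\<epsilon>. b (\<beta>, m) + (\<Sum>p\<in>S - {(\<beta>, m)}. b p * (divergent_scale p \<epsilon> / divergent_scale (\<beta>, m) \<epsilon>)))
        \<longlongrightarrow> b (\<beta>, m) + (\<Sum>p\<in>S - {(\<beta>, m)}. b p * 0)) (at_right 0)"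
    proof (intro tendsto_intros)
      fix p assume "p \<in> S - {(\<beta>, m)}"
      then show "((\<lambda>\<epsilon>. divergent_scale p \<epsilon> / divergent_scale (\<beta>, m) \<epsilon>) \<longlongrightarrow> 0) (at_right 0)"
        using lex[of "fst p" "snd p"] by (cases p) (auto intro!: divergent_scale_ratio_tendsto_0)
    qed
    ultimately have "b (\<beta>, m) = 0"
      using tendsto_unique[OF trivial_limit_at_right_real] by fastforce
    then have "(\<Sum>p\<in>S. b p * divergent_scale p \<epsilon>) = (\<Sum>p\<in>S - {(\<beta>, m)}. b p * divergent_scale p \<epsilon>)" for \<epsilon>
      by (simp add: sum.remove[OF psubset.hyps(1) p])
    with psubset.prems p show ?thesis
      by (intro psubset.IH[of "S - {(\<beta>, m)}"]) auto
  qed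
qed

text \<open>The pairs \<open>(\<beta> j, m j)\<close> need not be distinct.\<close>
definition divergent_sum :: "(real \<Rightarrow> complex) \<Rightarrow> bool" where
  "divergent_sum D \<longleftrightarrow> (\<exists>N a \<beta> m. (\<forall>j<N. \<beta> j > 0 \<or> (\<beta> j = 0 \<and> m j > 0)) \<and>
     D = (\<lambda>\<epsilon>. \<Sum>j<N::nat. a j * divergent_scale (\<beta> j, m j) \<epsilon>))"

lemma divergent_sumI:
  assumes "\<forall>j<N. \<beta> j > 0 \<or> (\<beta> j = 0 \<and> m j > 0)"
  shows "divergent_sum (\<lambda>\<epsilon>. \<Sum>j<N::nat. a j * divergent_scale (\<beta> j, m j) \<epsilon>)"
  unfolding divergent_sum_def using assms by (intro exI[of _ N] exI[of _ a] exI[of _ \<beta>] exI[of _ m]) simp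

lemma divergent_sumE:
  assumes "divergent_sum D"
  obtains N :: nat and \<beta> m a where "\<forall>j<N. \<beta> j > 0 \<or> (\<beta> j = 0 \<and> m j > 0)"
    "D = (\<lambda>\<epsilon>. \<Sum>j<N. a j * divergent_scale (\<beta> j, m j) \<epsilon>)"
  using assms unfolding divergent_sum_def by (elim exE conjE) (rule that)

lemma has_finite_partI:
  assumes "divergent_sum D" "((\<lambda>\<epsilon>. I \<epsilon> - D \<epsilon>) \<longlongrightarrow> c) (at_right 0)"
  shows "has_finite_part I c"
proof -
  from assms(1) obtain N :: nat and \<beta> m a where "\<forall>j<N. \<beta> j > 0 \<or> (\<beta> j = 0 \<and> m j > 0)"
    "D = (\<lambda>\<epsilon>. \<Sum>j<N. a j * divergent_scale (\<beta> j, m j) \<epsilon>)" by (rule divergent_sumE)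
  then show ?thesis unfolding has_finite_part_def using assms(2)
    by (intro exI[of _ N] exI[of _ a] exI[of _ \<beta>] exI[of _ m]) (simp add: divergent_scale_def)
qed

lemma has_finite_partE:
  assumes "has_finite_part I c"
  obtains D where "divergent_sum D" "((\<lambda>\<epsilon>. I \<epsilon> - D \<epsilon>) \<longlongrightarrow> c) (at_right 0)"
  using assms unfolding has_finite_part_def
proof (elim exE conjE)
  fix N :: nat and a \<beta> m
  assume *: "\<forall>j<N. \<beta> j > 0 \<or> (\<beta> j = 0 \<and> m j > (0::nat))"
    "((\<lambda>\<epsilon>. I \<epsilon> - (\<Sum>j<N. a j * complex_of_real (\<epsilon> powr (- \<beta> j) * ln (1 / \<epsilon>) ^ m j))) \<longlongrightarrow> c) (at_right 0)"
  show thesis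
    by (rule that[OF divergent_sumI[of N \<beta> m a]]) (use * in \<open>simp_all add: divergent_scale_def\<close>)
qed

lemma divergent_sum_cmult:
  assumes "divergent_sum D"
  shows "divergent_sum (\<lambda>\<epsilon>. z * D \<epsilon>)"
proof -
  from assms(1) obtain N :: nat and \<beta> m a where 1: "\<forall>j<N. \<beta> j > 0 \<or> (\<beta> j = 0 \<and> m j > 0)"
    "D = (\<lambda>\<epsilon>. \<Sum>j<N. a j * divergent_scale (\<beta> j, m j) \<epsilon>)" by (rule divergent_sumE)
  show ?thesis
    using divergent_sumI[of N \<beta> m "\<lambda>j. z * a j"] 1 by (simp add: sum_distrib_left mult.assoc)
qed

lemma divergent_sum_add:
  assumes "divergent_sum D" "divergent_sum E"
  shows "divergent_sum (\<lambda>\<epsilon>. D \<epsilon> + E \<epsilon>)"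
proof -
  from assms(1) obtain N :: nat and \<beta> m a where 1: "\<forall>j<N. \<beta> j > 0 \<or> (\<beta> j = 0 \<and> m j > 0)"
    "D = (\<lambda>\<epsilon>. \<Sum>j<N. a j * divergent_scale (\<beta> j, m j) \<epsilon>)" by (rule divergent_sumE)
  from assms(2) obtain N' :: nat and \<beta>' m' a' where 2: "\<forall>j<N'. \<beta>' j > 0 \<or> (\<beta>' j = 0 \<and> m' j > 0)"
    "E = (\<lambda>\<epsilon>. \<Sum>j<N'. a' j * divergent_scale (\<beta>' j, m' j) \<epsilon>)" by (rule divergent_sumE)
  let ?a = "\<lambda>j. if j < N then a j else a' (j - N)"
  let ?\<beta> = "\<lambda>j. if j < N then \<beta> j else \<beta>' (j - N)"
  let ?m = "\<lambda>j. if j < N then m j else m' (j - N)"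
  let ?t = "\<lambda>\<epsilon> j. ?a j * divergent_scale (?\<beta> j, ?m j) \<epsilon>"
  have "(\<Sum>j<N + N'. ?t \<epsilon> j) = D \<epsilon> + E \<epsilon>" for \<epsilon>
  proof -
    have "(\<Sum>j<N + N'. ?t \<epsilon> j) = (\<Sum>j<N. ?t \<epsilon> j) + (\<Sum>j<N'. ?t \<epsilon> (N + j))"
      by (induction N') (simp_all add: add.assoc)
    then show ?thesis by (simp add: 1 2)
  qed
  then show ?thesis
    using divergent_sumI[of "N + N'" ?\<beta> ?m ?a] 1(1) 2(1) by simp
qed

text \<open>Collecting the coefficients of equal pairs reduces this to distinct scales.\<close>

lemma divergent_sum_tendsto_imp_0:
  assumes "divergent_sum D" "(D \<longlongrightarrow> c) (at_right 0)"
  shows "c = 0"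
proof -
  from assms(1) obtain N :: nat and \<beta> m a where 1: "\<forall>j<N. \<beta> j > 0 \<or> (\<beta> j = 0 \<and> m j > 0)"
    "D = (\<lambda>\<epsilon>. \<Sum>j<N. a j * divergent_scale (\<beta> j, m j) \<epsilon>)" by (rule divergent_sumE)
  define q where "q = (\<lambda>j. (\<beta> j, m j))"
  define b where "b = (\<lambda>p. \<Sum>j | j \<in> {..<N} \<and> q j = p. a j)"
  have "D = (\<lambda>\<epsilon>. \<Sum>p\<in>q ` {..<N}. b p * divergent_scale p \<epsilon>)"
  proof
    fix \<epsilon>
    have "D \<epsilon> = (\<Sum>p\<in>q ` {..<N}. \<Sum>j | j \<in> {..<N} \<and> q j = p. a j * divergent_scale (q j) \<epsilon>)"
      unfolding 1(2) by (subst sum.group) (auto simp: q_def)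
    then show "D \<epsilon> = (\<Sum>p\<in>q ` {..<N}. b p * divergent_scale p \<epsilon>)"
      by (simp add: sum_distrib_right b_def)
  qed
  with assms(2) show ?thesis
    using 1(1) by (intro divergent_sum_distinct_tendsto_imp_0[of "q ` {..<N}" b]) (auto simp: q_def)
qed

text \<open>The difference of the two subtracted divergent sums is itself a divergent sum, and it
  converges to \<open>d - c\<close>.\<close>

lemma has_finite_part_unique:
  assumes "has_finite_part I c" "has_finite_part I d"
  shows "c = d"
proof -
  obtain D where D: "divergent_sum D" "((\<lambda>\<epsilon>. I \<epsilon> - D \<epsilon>) \<longlongrightarrow> c) (at_right 0)"
    using assms(1) by (rule has_finite_partE)
  obtain E where E: "divergent_sum E" "((\<lambda>\<epsilon>. I \<epsilon> - E \<epsilon>) \<longlongrightarrow> d) (at_right 0)"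
    using assms(2) by (rule has_finite_partE)
  have "d - c = 0"
    using tendsto_diff[OF E(2) D(2)]
    by (intro divergent_sum_tendsto_imp_0[OF divergent_sum_add[OF D(1) divergent_sum_cmult[OF E(1), of "-1"]]])
      (simp add: algebra_simps)
  then show ?thesis by simp
qed

lemma finite_part_eqI: "has_finite_part I c \<Longrightarrow> finite_part I = c"
  unfolding finite_part_def by (rule the_equality) (auto intro: has_finite_part_unique)

lemma has_finite_part_tendsto: "(I \<longlongrightarrow> c) (at_right 0) \<Longrightarrow> has_finite_part I c"
  using has_finite_partI[OF divergent_sumI[of 0]] by simp

text \<open>A negative power is itself one of the discarded terms and a positive power tends to 0;
  only exponent 0 would leave a constant.\<close>

lemma has_finite_part_powr_0:
  assumes "\<beta> \<noteq> 0"
  shows "has_finite_part (\<lambda>\<epsilon>. complex_of_real (\<epsilon> powr \<beta>)) 0"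
proof (cases "\<beta> > 0")
  case True
  have "((\<lambda>\<epsilon>::real. \<epsilon> powr \<beta>) \<longlongrightarrow> 0) (at_right 0)" using True by real_asymp
  from tendsto_of_real[OF this, where ?'a=complex] show ?thesis by (intro has_finite_part_tendsto) simp
next
  case False
  then show ?thesis using assms
    by (intro has_finite_partI[OF divergent_sumI[of 1 "\<lambda>_. -\<beta>" "\<lambda>_. 0" "\<lambda>_. 1"]])
      (auto simp: divergent_scale_def)
qed

lemma has_finite_part_cong:
  assumes "has_finite_part I c" "eventually (\<lambda>\<epsilon>. I \<epsilon> = J \<epsilon>) (at_right 0)"
  shows "has_finite_part J c"
proof -
  obtain D where D: "divergent_sum D" "((\<lambda>\<epsilon>. I \<epsilon> - D \<epsilon>) \<longlongrightarrow> c) (at_right 0)"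
    using assms(1) by (rule has_finite_partE)
  have "((\<lambda>\<epsilon>. J \<epsilon> - D \<epsilon>) \<longlongrightarrow> c) (at_right 0)"
    by (rule Lim_transform_eventually[OF D(2)]) (use assms(2) in eventually_elim, simp)
  with D(1) show ?thesis by (rule has_finite_partI)
qed

lemma has_finite_part_cmult:
  assumes "has_finite_part I c"
  shows "has_finite_part (\<lambda>\<epsilon>. z * I \<epsilon>) (z * c)"
proof -
  obtain D where D: "divergent_sum D" "((\<lambda>\<epsilon>. I \<epsilon> - D \<epsilon>) \<longlongrightarrow> c) (at_right 0)"
    using assms(1) by (rule has_finite_partE)
  show ?thesis
    using tendsto_mult_left[OF D(2), of z]
    by (intro has_finite_partI[OF divergent_sum_cmult[OF D(1), of z]]) (simp add: right_diff_distrib)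
qed

lemma has_finite_part_add:
  assumes "has_finite_part I c" "has_finite_part J d"
  shows "has_finite_part (\<lambda>\<epsilon>. I \<epsilon> + J \<epsilon>) (c + d)"
proof -
  obtain D where D: "divergent_sum D" "((\<lambda>\<epsilon>. I \<epsilon> - D \<epsilon>) \<longlongrightarrow> c) (at_right 0)"
    using assms(1) by (rule has_finite_partE)
  obtain E where E: "divergent_sum E" "((\<lambda>\<epsilon>. J \<epsilon> - E \<epsilon>) \<longlongrightarrow> d) (at_right 0)"
    using assms(2) by (rule has_finite_partE)
  show ?thesis
    using tendsto_add[OF D(2) E(2)]
    by (intro has_finite_partI[OF divergent_sum_add[OF D(1) E(1)]]) (simp add: algebra_simps)
qed

lemma has_finite_part_sum:
  assumes "\<And>i. i \<in> A \<Longrightarrow> has_finite_part (I i) (c i)"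
  shows "has_finite_part (\<lambda>\<epsilon>. \<Sum>i\<in>A. I i \<epsilon>) (\<Sum>i\<in>A. c i)"
  using assms
proof (induction A rule: infinite_finite_induct)
  case (insert i A)
  then show ?case by (simp add: has_finite_part_add)
qed (auto intro!: has_finite_part_tendsto)

section \<open>Schwartz functions and their Fourier transforms\<close>

text \<open>To show membership it is enough to exhibit a class of rapidly decreasing functions
  closed under differentiation. The closure properties below choose the class as a family of
  expressions, so iterated derivatives never have to be computed.\<close>

lemma schwartz_coinduct:
  assumes P: "P f"
    and deriv: "\<And>f. P f \<Longrightarrow> \<exists>f'. P f' \<and> (\<forall>x. (f has_vector_derivative f' x) (at x))"
    and bound: "\<And>f k. P f \<Longrightarrow> \<exists>C. \<forall>x. \<bar>x\<bar> ^ k * cmod (f x) \<le> C"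
  shows "schwartz f"
proof -
  have step: "P (vderiv g) \<and> (\<forall>x. (g has_vector_derivative vderiv g x) (at x))" if g: "P g" for g
  proof -
    obtain g' where g': "P g'" "\<forall>x. (g has_vector_derivative g' x) (at x)"
      using deriv[OF g] by blast
    then have "vderiv g = g'" unfolding vderiv_def by (auto intro: vector_derivative_at)
    with g' show ?thesis by simp
  qed
  have iter: "P ((vderiv ^^ n) f)" for n by (induction n) (auto simp: P step)
  have "smooth f" unfolding smooth_def using step[OF iter] by simp
  moreover have "bounded (range (\<lambda>x. complex_of_real x ^ k * (vderiv ^^ n) f x))" for k n
    using bound[OF iter[of n], of k] by (auto simp: bounded_iff norm_mult norm_power)
  ultimately show ?thesis by (simp add: schwartz_def)
qed

lemma schwartz_has_vector_derivative:
  assumes "schwartz f"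
  shows "(f has_vector_derivative vderiv f x) (at x)"
proof -
  have "((vderiv ^^ 0) f has_vector_derivative (vderiv ^^ Suc 0) f x) (at x)"
    using assms unfolding schwartz_def smooth_def by blast
  then show ?thesis by simp
qed

lemma schwartz_funpow_vderiv:
  assumes "schwartz f"
  shows "schwartz ((vderiv ^^ m) f)"
proof -
  have eq: "(vderiv ^^ n) ((vderiv ^^ m) f) = (vderiv ^^ (n + m)) f" for n
    by (simp add: funpow_add)
  have "((vderiv ^^ n) f has_vector_derivative (vderiv ^^ Suc n) f x) (at x)"
       "bounded (range (\<lambda>x. complex_of_real x ^ k * (vderiv ^^ n) f x))" for n x k
    using assms unfolding schwartz_def smooth_def by blast+
  from this(1)[of "_ + m"] this(2)[of _ "_ + m"] show ?thesis
    unfolding schwartz_def smooth_def eq by simp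
qed

lemma schwartz_vderiv: "schwartz f \<Longrightarrow> schwartz (vderiv f)"
  using schwartz_funpow_vderiv[of f 1] by simp

lemma schwartz_bound:
  assumes "schwartz f"
  obtains C where "C \<ge> 0" "\<And>x. \<bar>x\<bar> ^ k * cmod (f x) \<le> C"
proof -
  have "bounded (range (\<lambda>x. complex_of_real x ^ k * (vderiv ^^ 0) f x))"
    using assms unfolding schwartz_def by blast
  then obtain C where C: "\<And>x. \<bar>x\<bar> ^ k * cmod (f x) \<le> C"
    by (auto simp: bounded_iff norm_mult norm_power)
  from C[of 0] have "C \<ge> 0" using order_trans[of 0 "\<bar>0\<bar> ^ k * cmod (f 0)" C] by simp
  with C that show thesis by blast
qed

lemma schwartz_add:
  assumes "schwartz f" "schwartz g"
  shows "schwartz (\<lambda>x. f x + g x)"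
proof (rule schwartz_coinduct[where P = "\<lambda>h. \<exists>f g. schwartz f \<and> schwartz g \<and> h = (\<lambda>x. f x + g x)"])
  fix h k
  assume "\<exists>f g. schwartz f \<and> schwartz g \<and> h = (\<lambda>x. f x + g x)"
  then obtain f g where fg: "schwartz f" "schwartz g" and h: "h = (\<lambda>x. f x + g x)" by blast
  show "\<exists>h'. (\<exists>f g. schwartz f \<and> schwartz g \<and> h' = (\<lambda>x. f x + g x)) \<and> (\<forall>x. (h has_vector_derivative h' x) (at x))"
    unfolding h using fg
    by (intro exI[of _ "\<lambda>x. vderiv f x + vderiv g x"] conjI allI exI[of _ "vderiv f"] exI[of _ "vderiv g"])
      (auto intro!: has_vector_derivative_add schwartz_has_vector_derivative schwartz_vderiv)
  obtain C D where "\<And>x. \<bar>x\<bar> ^ k * cmod (f x) \<le> C" "\<And>x. \<bar>x\<bar> ^ k * cmod (g x) \<le> D"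
    using fg by (metis schwartz_bound)
  then have "\<bar>x\<bar> ^ k * cmod (h x) \<le> C + D" for x
    unfolding h
    by (smt (verit) norm_triangle_ineq mult_left_mono zero_le_power abs_ge_zero distrib_left)
  then show "\<exists>C. \<forall>x. \<bar>x\<bar> ^ k * cmod (h x) \<le> C" by blast
qed (use assms in blast)

lemma schwartz_cmult:
  assumes "schwartz f"
  shows "schwartz (\<lambda>x. c * f x)"
proof (rule schwartz_coinduct[where P = "\<lambda>h. \<exists>f. schwartz f \<and> h = (\<lambda>x. c * f x)"])
  fix h k
  assume "\<exists>f. schwartz f \<and> h = (\<lambda>x. c * f x)"
  then obtain f where f: "schwartz f" and h: "h = (\<lambda>x. c * f x)" by blast
  show "\<exists>h'. (\<exists>f. schwartz f \<and> h' = (\<lambda>x. c * f x)) \<and> (\<forall>x. (h has_vector_derivative h' x) (at x))"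
    unfolding h using f
    by (intro exI[of _ "\<lambda>x. c * vderiv f x"] conjI allI exI[of _ "vderiv f"])
      (auto intro!: has_vector_derivative_mult_right schwartz_has_vector_derivative schwartz_vderiv)
  obtain C where "\<And>x. \<bar>x\<bar> ^ k * cmod (f x) \<le> C"
    using f by (metis schwartz_bound)
  then have "\<bar>x\<bar> ^ k * cmod (h x) \<le> cmod c * C" for x
    using mult_left_mono[of "\<bar>x\<bar> ^ k * cmod (f x)" C "cmod c"] unfolding h
    by (simp add: norm_mult mult_ac)
  then show "\<exists>C. \<forall>x. \<bar>x\<bar> ^ k * cmod (h x) \<le> C" by blast
qed (use assms in blast)

text \<open>The derivative of x f is x f' + f, so the invariant must be enlarged to all functions x
  f + g with Schwartz f and g.\<close>

lemma schwartz_times_x: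
  assumes "schwartz f"
  shows "schwartz (\<lambda>x. complex_of_real x * f x)"
proof (rule schwartz_coinduct[where
      P = "\<lambda>h. \<exists>f g. schwartz f \<and> schwartz g \<and> h = (\<lambda>x. complex_of_real x * f x + g x)"])
  have "schwartz (\<lambda>x. 0)" using schwartz_cmult[OF assms, of 0] by simp
  then show "\<exists>u v. schwartz u \<and> schwartz v \<and> (\<lambda>x. complex_of_real x * f x) = (\<lambda>x. complex_of_real x * u x + v x)"
    using assms by force
  fix h k
  assume "\<exists>f g. schwartz f \<and> schwartz g \<and> h = (\<lambda>x. complex_of_real x * f x + g x)"
  then obtain f g where fg: "schwartz f" "schwartz g"
    and h: "h = (\<lambda>x. complex_of_real x * f x + g x)" by blast
  show "\<exists>h'. (\<exists>f g. schwartz f \<and> schwartz g \<and> h' = (\<lambda>x. complex_of_real x * f x + g x)) \<and> (\<forall>x. (h has_vector_derivative h' x) (at x))"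
    unfolding h
  proof (rule exI[of _ "\<lambda>x. complex_of_real x * vderiv f x + (f x + vderiv g x)"], rule conjI)
    show "\<exists>u v. schwartz u \<and> schwartz v \<and> (\<lambda>x. complex_of_real x * vderiv f x + (f x + vderiv g x))
        = (\<lambda>x. complex_of_real x * u x + v x)"
      using schwartz_vderiv[OF fg(1)] schwartz_add[OF fg(1) schwartz_vderiv[OF fg(2)]] by blast
    show "\<forall>x. ((\<lambda>x. complex_of_real x * f x + g x) has_vector_derivative
       complex_of_real x * vderiv f x + (f x + vderiv g x)) (at x)"
      by (rule allI, rule has_vector_derivative_eq_rhs, rule has_vector_derivative_add[OF has_vector_derivative_mult
            [OF has_vector_derivative_of_real[OF DERIV_ident] schwartz_has_vector_derivative[OF fg(1)]]
            schwartz_has_vector_derivative[OF fg(2)]]) simp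
  qed
  obtain C D where CD: "\<And>x. \<bar>x\<bar> ^ Suc k * cmod (f x) \<le> C" "\<And>x. \<bar>x\<bar> ^ k * cmod (g x) \<le> D"
    using fg by (metis schwartz_bound)
  have "\<bar>x\<bar> ^ k * cmod (h x) \<le> C + D" for x
  proof -
    have "\<bar>x\<bar> ^ k * cmod (h x) \<le> \<bar>x\<bar> ^ k * (\<bar>x\<bar> * cmod (f x) + cmod (g x))"
      unfolding h by (intro mult_left_mono order_trans[OF norm_triangle_ineq]) (auto simp: norm_mult)
    also have "\<dots> \<le> C + D" using CD[of x] by (simp add: algebra_simps)
    finally show ?thesis .
  qed
  then show "\<exists>C. \<forall>x. \<bar>x\<bar> ^ k * cmod (h x) \<le> C" by blast
qed

lemma has_vector_derivative_reflect:
  assumes "schwartz f"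
  shows "((\<lambda>x. f (- x)) has_vector_derivative - vderiv f (- x)) (at x)"
  using vector_diff_chain_at[OF has_vector_derivative_minus[OF has_vector_derivative_id]
      schwartz_has_vector_derivative[OF assms], of x]
  by (simp add: o_def)

lemma schwartz_reflect:
  assumes "schwartz f"
  shows "schwartz (\<lambda>x. f (- x))"
proof (rule schwartz_coinduct[where P = "\<lambda>h. \<exists>f. schwartz f \<and> h = (\<lambda>x. f (- x))"])
  fix h k
  assume "\<exists>f. schwartz f \<and> h = (\<lambda>x. f (- x))"
  then obtain f where f: "schwartz f" and h: "h = (\<lambda>x. f (- x))" by blast
  show "\<exists>h'. (\<exists>f. schwartz f \<and> h' = (\<lambda>x. f (- x))) \<and> (\<forall>x. (h has_vector_derivative h' x) (at x))"
    unfolding h using f schwartz_cmult[OF schwartz_vderiv[OF f], of "-1"] has_vector_derivative_reflect[OF f]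
    by (intro exI[of _ "\<lambda>x. - vderiv f (- x)"] conjI allI exI[of _ "\<lambda>x. - vderiv f x"]) auto
  obtain C where "\<And>x. \<bar>x\<bar> ^ k * cmod (f x) \<le> C"
    using f by (metis schwartz_bound)
  from this[of "- _"] show "\<exists>C. \<forall>x. \<bar>x\<bar> ^ k * cmod (h x) \<le> C" by (auto simp: h)
qed (use assms in blast)

lemma vderiv_reflect: "schwartz f \<Longrightarrow> vderiv (\<lambda>x. f (- x)) = (\<lambda>x. - vderiv f (- x))"
  using has_vector_derivative_reflect unfolding vderiv_def by (auto intro: vector_derivative_at)

lemma schwartz_isCont: "schwartz f \<Longrightarrow> isCont f x"
  using schwartz_has_vector_derivative has_vector_derivative_continuous by blast

lemma schwartz_borel_measurable: "schwartz f \<Longrightarrow> f \<in> borel_measurable borel"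
  by (intro borel_measurable_continuous_onI continuous_at_imp_continuous_on) (simp add: schwartz_isCont)

text \<open>The bounds on f and on x^2 f combine to domination by a multiple of 1 / (1 +
  x^2).\<close>

lemma schwartz_integrable:
  assumes "schwartz f"
  shows "integrable lborel f"
proof -
  obtain C D where CD: "C \<ge> 0" "D \<ge> 0" "\<And>x. \<bar>x\<bar> ^ 0 * cmod (f x) \<le> C" "\<And>x. \<bar>x\<bar> ^ 2 * cmod (f x) \<le> D"
    using assms by (metis schwartz_bound)
  have "integrable lborel (\<lambda>x::real. (C + D) * inverse (1 + x^2))"
    using integrable_inverse_1_plus_square by (simp add: set_integrable_def)
  then show ?thesis
  proof (rule Bochner_Integration.integrable_bound)
    show "f \<in> borel_measurable lborel" using schwartz_borel_measurable[OF assms] by simp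
    have "cmod (f x) \<le> (C + D) * inverse (1 + x^2)" for x
    proof -
      have "(1 + x^2) * cmod (f x) \<le> C + D" using CD(3,4)[of x] by (simp add: algebra_simps)
      moreover have "1 + x^2 > 0" by (simp add: add_pos_nonneg)
      ultimately show ?thesis by (simp add: field_simps)
    qed
    then show "AE x in lborel. norm (f x) \<le> norm ((C + D) * inverse (1 + x\<^sup>2))"
      using CD(1,2) by (intro always_eventually allI) (simp add: order_trans[OF _ abs_ge_self])
  qed
qed

lemma schwartz_tendsto_at_infinity:
  assumes "schwartz f"
  shows "(f \<longlongrightarrow> 0) at_infinity"
proof -
  obtain C where C: "\<And>x. \<bar>x\<bar> ^ 1 * cmod (f x) \<le> C" using assms by (metis schwartz_bound)
  have "((\<lambda>x::real. C * inverse (norm x)) \<longlongrightarrow> C * 0) at_infinity"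
    by (intro tendsto_intros tendsto_inverse_0_at_top filterlim_at_infinity_imp_norm_at_top filterlim_ident)
  moreover have "eventually (\<lambda>x. norm (f x) \<le> C * inverse (norm x)) at_infinity"
    unfolding eventually_at_infinity
  proof (intro exI[of _ 1] allI impI)
    fix x :: real assume "1 \<le> norm x"
    then show "norm (f x) \<le> C * inverse (norm x)" using C[of x] by (simp add: field_simps)
  qed
  ultimately show ?thesis using Lim_null_comparison by simp
qed

lemma schwartz_tendsto_at_top: "schwartz f \<Longrightarrow> (f \<longlongrightarrow> 0) at_top"
  and schwartz_tendsto_at_bot: "schwartz f \<Longrightarrow> (f \<longlongrightarrow> 0) at_bot"
  using tendsto_mono[OF at_top_le_at_infinity schwartz_tendsto_at_infinity]
    tendsto_mono[OF at_bot_le_at_infinity schwartz_tendsto_at_infinity] by blast+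


section \<open>Fourier transforms of integrable functions, and their action on Schwartz
  functions\<close>

lemma fourier_eq_lborel:
  assumes "integrable lborel f"
  shows "fourier f k = (LINT x|lborel. f x * exp (- \<i> * complex_of_real (k * x)))"
    and "integrable lborel (\<lambda>x. f x * exp (- \<i> * complex_of_real (k * x)))"
proof -
  have [measurable]: "f \<in> borel_measurable borel" using assms by (simp add: borel_measurable_integrable)
  show int: "integrable lborel (\<lambda>x. f x * exp (- \<i> * complex_of_real (k * x)))"
    by (rule Bochner_Integration.integrable_bound[OF assms]) (auto simp: norm_mult)
  show "fourier f k = (LINT x|lborel. f x * exp (- \<i> * complex_of_real (k * x)))"
    unfolding fourier_def by (rule integral_lborel[OF int])
qed

lemma norm_fourier_le:
  assumes "integrable lborel f"
  shows "cmod (fourier f k) \<le> (LINT x|lborel. cmod (f x))"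
  unfolding fourier_eq_lborel(1)[OF assms]
  by (rule order_trans[OF integral_norm_bound]) (simp add: norm_mult)

lemma fourier_cmult:
  assumes "integrable lborel f"
  shows "fourier (\<lambda>x. c * f x) k = c * fourier f k"
  using fourier_eq_lborel[OF assms, of k] fourier_eq_lborel(1)[of "\<lambda>x. c * f x" k] assms
  by (simp add: mult.assoc)

lemma norm_exp_i_remainder:
  "cmod (exp (- \<i> * complex_of_real t) - 1 + \<i> * complex_of_real t) \<le> t\<^sup>2 / 2"
  using iexp_approx1[of "-t" 1] by (simp add: power2_eq_square algebra_simps)

text \<open>A quadratic bound on the remainder turns differentiation under the integral sign into a
  single norm estimate.\<close>

lemma has_vector_derivative_quadratic_remainder:
  fixes f :: "real \<Rightarrow> 'a::real_normed_vector"
  assumes "\<And>h. norm (f (x + h) - f x - h *\<^sub>R D) \<le> C * h\<^sup>2"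
  shows "(f has_vector_derivative D) (at x)"
proof -
  have "((\<lambda>h. norm (f (x + h) - f x - h *\<^sub>R D) / norm h) \<longlongrightarrow> 0) (at 0)"
  proof (rule Lim_null_comparison)
    show "eventually (\<lambda>h. norm (norm (f (x + h) - f x - h *\<^sub>R D) / norm h) \<le> C * \<bar>h\<bar>) (at 0)"
      unfolding eventually_at_filter
    proof (intro always_eventually allI impI)
      fix h :: real assume "h \<noteq> 0"
      then show "norm (norm (f (x + h) - f x - h *\<^sub>R D) / norm h) \<le> C * \<bar>h\<bar>"
        using assms[of h] by (simp add: divide_le_eq power2_eq_square abs_mult[symmetric] mult.assoc)
    qed
    show "((\<lambda>h::real. C * \<bar>h\<bar>) \<longlongrightarrow> 0) (at 0)"
      by (intro tendsto_eq_intros) auto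
  qed
  then show ?thesis
    unfolding has_vector_derivative_def has_derivative_at
    by (simp add: bounded_linear_scaleR_left)
qed

text \<open>The second-order remainder of e^(-ihx) is at most (hx)^2 / 2, so a finite second moment
  yields the quadratic bound. Stating this for integrable functions makes it available for the
  damped powers, which are not Schwartz.\<close>

lemma fourier_has_vector_derivative:
  assumes f: "integrable lborel f" and f2: "integrable lborel (\<lambda>x. complex_of_real (x\<^sup>2) * f x)"
  shows "(fourier f has_vector_derivative fourier (\<lambda>x. - \<i> * (complex_of_real x * f x)) k) (at k)"
proof (rule has_vector_derivative_quadratic_remainder)
  have [measurable]: "f \<in> borel_measurable borel" using f by (simp add: borel_measurable_integrable)
  have f1: "integrable lborel (\<lambda>x. - \<i> * (complex_of_real x * f x))"
  proof (rule Bochner_Integration.integrable_bound)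
    show "integrable lborel (\<lambda>x. cmod (f x) + cmod (complex_of_real (x\<^sup>2) * f x))"
      using f f2 by (intro Bochner_Integration.integrable_add integrable_norm)
    have "\<bar>x\<bar> \<le> 1 + x\<^sup>2" for x :: real
      using abs_le_square_iff[of 1 x] power2_abs[of x] by (smt (verit) power2_eq_square mult_left_le_imp_le mult_le_cancel_left1 zero_le_power2)
    then have "\<bar>x\<bar> * cmod (f x) \<le> (1 + x\<^sup>2) * cmod (f x)" for x by (rule mult_right_mono) simp
    then show "AE x in lborel. norm (- \<i> * (complex_of_real x * f x)) \<le> norm (cmod (f x) + cmod (complex_of_real (x\<^sup>2) * f x))"
      by (intro always_eventually allI) (simp add: norm_mult algebra_simps norm_power)
  qed measurable
  fix h :: real
  let ?e = "\<lambda>x. exp (- \<i> * complex_of_real (k * x))"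
  note i1 = fourier_eq_lborel(2)[OF f, of "k + h"] and i2 = fourier_eq_lborel(2)[OF f, of k]
    and i3 = integrable_scaleR_right[OF fourier_eq_lborel(2)[OF f1, of k], of h]
  have "fourier f (k + h) - fourier f k - h *\<^sub>R fourier (\<lambda>x. - \<i> * (complex_of_real x * f x)) k
     = (LINT x|lborel. f x * exp (- \<i> * complex_of_real ((k + h) * x)) - f x * ?e x
          - h *\<^sub>R (- \<i> * (complex_of_real x * f x) * ?e x))"
    by (simp only: fourier_eq_lborel(1)[OF f] fourier_eq_lborel(1)[OF f1] integral_scaleR_right
        Bochner_Integration.integral_diff[OF Bochner_Integration.integrable_diff[OF i1 i2] i3]
        Bochner_Integration.integral_diff[OF i1 i2])
  also have "norm \<dots> \<le> (LINT x|lborel. h\<^sup>2 / 2 * cmod (complex_of_real (x\<^sup>2) * f x))"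
  proof (rule Bochner_Integration.integral_norm_bound_integral)
    show "integrable lborel (\<lambda>x. f x * exp (- \<i> * complex_of_real ((k + h) * x)) - f x * ?e x
          - h *\<^sub>R (- \<i> * (complex_of_real x * f x) * ?e x))"
      by (intro Bochner_Integration.integrable_diff i1 i2 i3)
    show "integrable lborel (\<lambda>x. h\<^sup>2 / 2 * cmod (complex_of_real (x\<^sup>2) * f x))"
      using f2 by (intro integrable_mult_right integrable_norm)
    fix x :: real
    have "exp (- \<i> * complex_of_real ((k + h) * x)) = ?e x * exp (- \<i> * complex_of_real (h * x))"
      by (simp add: exp_add[symmetric] algebra_simps)
    then have "f x * exp (- \<i> * complex_of_real ((k + h) * x)) - f x * ?e x
          - h *\<^sub>R (- \<i> * (complex_of_real x * f x) * ?e x)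
        = f x * ?e x * (exp (- \<i> * complex_of_real (h * x)) - 1 + \<i> * complex_of_real (h * x))"
      by (simp add: algebra_simps scaleR_conv_of_real)
    also have "cmod \<dots> \<le> cmod (f x) * ((h * x)\<^sup>2 / 2)"
      unfolding norm_mult by (rule order_trans[OF mult_mono[OF _ norm_exp_i_remainder]]) auto
    finally show "norm (f x * exp (- \<i> * complex_of_real ((k + h) * x)) - f x * ?e x
          - h *\<^sub>R (- \<i> * (complex_of_real x * f x) * ?e x)) \<le> h\<^sup>2 / 2 * cmod (complex_of_real (x\<^sup>2) * f x)"
      by (simp add: norm_mult power_mult_distrib norm_power mult_ac)
  qed
  finally show "norm (fourier f (k + h) - fourier f k - h *\<^sub>R fourier (\<lambda>x. - \<i> * (complex_of_real x * f x)) k)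
     \<le> ((LINT x|lborel. cmod (complex_of_real (x\<^sup>2) * f x)) / 2) * h\<^sup>2"
    by (simp add: mult_ac)
qed

lemma fourier_schwartz_has_vector_derivative:
  assumes "schwartz f"
  shows "(fourier f has_vector_derivative fourier (\<lambda>x. - \<i> * (complex_of_real x * f x)) k) (at k)"
  using schwartz_integrable[OF assms] schwartz_integrable[OF schwartz_times_x[OF schwartz_times_x[OF assms]]]
  by (intro fourier_has_vector_derivative) (auto simp: power2_eq_square mult.assoc)

lemma vderiv_fourier:
  "schwartz f \<Longrightarrow> vderiv (fourier f) = fourier (\<lambda>x. - \<i> * (complex_of_real x * f x))"
  unfolding vderiv_def by (rule ext, rule vector_derivative_at, rule fourier_schwartz_has_vector_derivative)

text \<open>Integration by parts; the exponential has modulus 1, so the decay of \<open>f\<close>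
  alone removes the boundary terms at both infinities.\<close>

lemma fourier_vderiv:
  assumes "schwartz f"
  shows "fourier (vderiv f) k = \<i> * complex_of_real k * fourier f k"
proof -
  let ?e = "\<lambda>x. exp (- \<i> * complex_of_real (k * x))"
  let ?f = "\<lambda>x. vderiv f x * ?e x + f x * (- \<i> * complex_of_real k * ?e x)"
  note int = fourier_eq_lborel[OF schwartz_integrable[OF assms], of k]
    fourier_eq_lborel[OF schwartz_integrable[OF schwartz_vderiv[OF assms]], of k]
  have int2: "integrable lborel (\<lambda>x. f x * (- \<i> * complex_of_real k * ?e x))"
    using integrable_mult_right[OF int(2), of "- \<i> * complex_of_real k"] by (simp add: mult_ac)
  have lim: "((\<lambda>x. f x * ?e x) \<longlongrightarrow> 0) F" if "(f \<longlongrightarrow> 0) F" for F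
    using that by (intro tendsto_norm_zero_cancel[of "\<lambda>x. f x * ?e x"]) (simp add: norm_mult tendsto_norm_zero)
  have "(LBINT x=-\<infinity>..\<infinity>. ?f x) = 0 - 0"
  proof (rule interval_integral_FTC_integrable[where F = "\<lambda>x. f x * ?e x"])
    have e: "(?e has_vector_derivative - \<i> * complex_of_real k * ?e x) (at x)" for x
      by (auto intro!: derivative_eq_intros has_vector_derivative_real_field)
    show "((\<lambda>x. f x * ?e x) has_vector_derivative ?f x) (at x)" for x
      by (rule has_vector_derivative_eq_rhs,
          rule has_vector_derivative_mult[OF schwartz_has_vector_derivative[OF assms] e])
        (simp add: algebra_simps)
    show "isCont ?f x" for x
      by (intro continuous_intros schwartz_isCont assms schwartz_vderiv)
    show "set_integrable lborel (einterval (- \<infinity>) \<infinity>) ?f"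
      using int(4) int2 by (simp add: set_integrable_def)
    show "(((\<lambda>x. f x * ?e x) \<circ> real_of_ereal) \<longlongrightarrow> 0) (at_right (- \<infinity>))"
      unfolding ereal_tendsto_simps by (rule lim[OF schwartz_tendsto_at_bot[OF assms]])
    show "(((\<lambda>x. f x * ?e x) \<circ> real_of_ereal) \<longlongrightarrow> 0) (at_left \<infinity>)"
      unfolding ereal_tendsto_simps by (rule lim[OF schwartz_tendsto_at_top[OF assms]])
  qed simp
  then have "(LINT x|lborel. ?f x) = 0"
    by (simp add: interval_lebesgue_integral_def set_lebesgue_integral_def)
  then have "fourier (vderiv f) k + (LINT x|lborel. (- \<i> * complex_of_real k) * (f x * ?e x)) = 0"
    using int(3,4) int2 by (simp add: mult_ac)
  then show ?thesis using int(1) by (simp add: eq_neg_iff_add_eq_0)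
qed

text \<open>Take the class of all transforms of Schwartz functions. It is closed under
  differentiation, since (F f)' = F(-ixf), and |k|^n |F f(k)| = |F(f^(n))(k)| is bounded by the L1
  norm of f^(n).\<close>

lemma schwartz_fourier:
  assumes "schwartz f"
  shows "schwartz (fourier f)"
proof (rule schwartz_coinduct[where P = "\<lambda>h. \<exists>f. schwartz f \<and> h = fourier f"])
  fix h k
  assume "\<exists>f. schwartz f \<and> h = fourier f"
  then obtain f where f: "schwartz f" and h: "h = fourier f" by blast
  show "\<exists>h'. (\<exists>f. schwartz f \<and> h' = fourier f) \<and> (\<forall>x. (h has_vector_derivative h' x) (at x))"
    unfolding h using fourier_schwartz_has_vector_derivative[OF f] schwartz_cmult[OF schwartz_times_x[OF f]]
    by blast
  have "fourier ((vderiv ^^ k) f) x = (\<i> * complex_of_real x) ^ k * fourier f x" for x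
    by (induction k) (simp_all add: fourier_vderiv schwartz_funpow_vderiv f)
  then have "\<bar>x\<bar> ^ k * cmod (h x) = cmod (fourier ((vderiv ^^ k) f) x)" for x
    by (simp add: norm_mult norm_power h)
  then show "\<exists>C. \<forall>x. \<bar>x\<bar> ^ k * cmod (h x) \<le> C"
    using norm_fourier_le[OF schwartz_integrable[OF schwartz_funpow_vderiv[OF f]]] by metis
qed (use assms in blast)

lemma fourier_reflect:
  assumes "schwartz f"
  shows "fourier (\<lambda>x. f (- x)) k = fourier f (- k)"
  using fourier_eq_lborel(1)[OF schwartz_integrable[OF assms], of "-k"]
    fourier_eq_lborel(1)[OF schwartz_integrable[OF schwartz_reflect[OF assms]], of k]
    lborel_integral_real_affine[of "-1" "\<lambda>x. f x * exp (- \<i> * complex_of_real (- k * x))" 0]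
  by simp

text \<open>Fubini for f(x) g(y) e^(-ixy), whose modulus is the integrable product |f(x)| |g(y)|.
  Mere integrability is assumed because one factor will be a damped power or a truncated
  reciprocal.\<close>

lemma fourier_multiplication_formula:
  assumes f: "integrable lborel f" and g: "integrable lborel g"
  shows "(LINT x|lborel. f x * fourier g x) = (LINT x|lborel. fourier f x * g x)"
proof -
  have [measurable]: "f \<in> borel_measurable borel" "g \<in> borel_measurable borel"
    using f g by (simp_all add: borel_measurable_integrable)
  let ?h = "\<lambda>x y. f x * (g y * exp (- \<i> * complex_of_real (x * y)))"
  have "integrable (lborel \<Otimes>\<^sub>M lborel) (case_prod ?h)"
  proof (rule lborel_pair.Fubini_integrable)
    show "integrable lborel (\<lambda>x. LINT y|lborel. norm (case_prod ?h (x, y)))"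
      using integrable_norm[OF f] by (simp add: norm_mult)
    show "AE x in lborel. integrable lborel (\<lambda>y. case_prod ?h (x, y))"
      using fourier_eq_lborel(2)[OF g] by simp
  qed measurable
  from lborel_pair.Fubini_integral[OF this]
  have "(LINT y|lborel. LINT x|lborel. ?h x y) = (LINT x|lborel. LINT y|lborel. ?h x y)" .
  moreover have "(LINT y|lborel. ?h x y) = f x * fourier g x" for x
    unfolding fourier_eq_lborel(1)[OF g] by simp
  moreover have "(LINT x|lborel. ?h x y) = fourier f y * g y" for y
  proof -
    have "?h x y = f x * exp (- \<i> * complex_of_real (y * x)) * g y" for x
      by (simp add: mult_ac)
    then show ?thesis
      unfolding fourier_eq_lborel(1)[OF f] by (simp only: integral_mult_left_zero)
  qed
  ultimately show ?thesis by (simp only:)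
qed

section \<open>Finite parts of integrals against one-sided powers\<close>

text \<open>The substitution t -> 1/t reduces the limit at 0+ to the dominated convergence theorem
  at infinity.\<close>

lemma integral_dominated_convergence_at_right:
  fixes f :: "'a \<Rightarrow> 'b::{banach, second_countable_topology}" and s :: "real \<Rightarrow> 'a \<Rightarrow> 'b"
  assumes "f \<in> borel_measurable M" "\<And>t. s t \<in> borel_measurable M" "integrable M w"
    and lim: "AE x in M. ((\<lambda>t. s t x) \<longlongrightarrow> f x) (at_right 0)"
    and bound: "eventually (\<lambda>t. AE x in M. norm (s t x) \<le> w x) (at_right 0)"
  shows "((\<lambda>t. integral\<^sup>L M (s t)) \<longlongrightarrow> integral\<^sup>L M f) (at_right 0)"
  unfolding filterlim_at_right_to_top
proof (rule integral_dominated_convergence_at_top[where w = w])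
  show "AE x in M. ((\<lambda>t. s (inverse t) x) \<longlongrightarrow> f x) at_top"
    using lim unfolding filterlim_at_right_to_top .
  show "eventually (\<lambda>t. AE x in M. norm (s (inverse t) x) \<le> w x) at_top"
    using bound unfolding eventually_at_right_to_top .
qed (use assms in auto)

text \<open>The pairing of \<open>f\<close> with x_+^a cut off at \<open>\<epsilon>\<close>.
  Restricting to a positive half-line permits real \<open>powr\<close>; the negative half-line is
  treated by reflecting \<open>f\<close>. At \<open>\<epsilon> = 0\<close> and \<open>a > -1\<close>
  this is the full convergent integral.\<close>

definition half_int :: "real \<Rightarrow> (real \<Rightarrow> complex) \<Rightarrow> real \<Rightarrow> complex" where
  "half_int a f \<epsilon> = (LINT x:{\<epsilon><..}|lborel. complex_of_real (x powr a) * f x)"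

lemma set_integrable_powr_0_1:
  assumes "a > -1"
  shows "set_integrable lborel {0<..1} (\<lambda>x::real. x powr a)"
proof -
  have "(\<lambda>x::real. x powr a) absolutely_integrable_on {0<..1}"
    using integrable_on_powr_from_0'[OF assms, of 1] by (intro nonnegative_absolutely_integrable_1) auto
  then show ?thesis
    unfolding set_integrable_def by (subst (asm) integrable_completion) auto
qed

lemma schwartz_power_mult:
  assumes "schwartz f"
  shows "schwartz (\<lambda>x. complex_of_real x ^ n * f x)"
proof (induction n)
  case (Suc n)
  from schwartz_times_x[OF this] show ?case by (simp add: mult.assoc)
qed (simp add: assms)

lemma powr_le_power_nat_ceiling: "1 \<le> x \<Longrightarrow> x powr a \<le> x ^ nat \<lceil>a\<rceil>" for x a :: real
  by (subst powr_realpow[symmetric]) (auto intro!: powr_mono simp: real_nat_ceiling_ge)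

text \<open>On (0,1] the integrand is dominated by a multiple of x^a, beyond 1 by the Schwartz
  function x^n f with n the rounded-up exponent.\<close>

lemma half_integrable_0:
  assumes f: "schwartz f" and a: "a > -1"
  shows "set_integrable lborel {0<..} (\<lambda>x. complex_of_real (x powr a) * f x)"
proof -
  note [measurable] = schwartz_borel_measurable[OF f]
  obtain C where C: "C \<ge> 0" "\<And>x. \<bar>x\<bar> ^ 0 * cmod (f x) \<le> C" using f by (metis schwartz_bound)
  let ?g = "\<lambda>x. complex_of_real x ^ nat \<lceil>a\<rceil> * f x"
  show ?thesis
    unfolding set_integrable_def
  proof (rule Bochner_Integration.integrable_bound)
    show "integrable lborel (\<lambda>x. C * (indicator {0<..1} x *\<^sub>R x powr a) + cmod (?g x))"
      using set_integrable_powr_0_1[OF a] schwartz_integrable[OF schwartz_power_mult[OF f]]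
      unfolding set_integrable_def
      by (intro Bochner_Integration.integrable_add integrable_mult_right integrable_norm)
    have "norm (indicator {0<..} x *\<^sub>R (complex_of_real (x powr a) * f x))
       \<le> C * (indicator {0<..1} x *\<^sub>R x powr a) + cmod (?g x)" for x
    proof (cases "x \<le> 0 \<or> x > 1")
      case False
      have "x powr a * cmod (f x) \<le> x powr a * C" using C(2)[of x] by (intro mult_left_mono) auto
      then show ?thesis using False by (simp add: norm_mult mult_ac add_increasing2)
    next
      case True
      then show ?thesis using C(1) powr_le_power_nat_ceiling[of x a]
        by (auto simp: norm_mult norm_power intro!: mult_right_mono)
    qed
    then show "AE x in lborel. norm (indicator {0<..} x *\<^sub>R (complex_of_real (x powr a) * f x))
       \<le> norm (C * (indicator {0<..1} x *\<^sub>R x powr a) + cmod (?g x))"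
      by (intro always_eventually allI) (simp add: order_trans[OF _ abs_ge_self])
  qed measurable
qed

lemma half_integrable:
  assumes f: "schwartz f" and e: "\<epsilon> > 0 \<or> \<epsilon> = 0 \<and> a > -1"
  shows "set_integrable lborel {\<epsilon><..} (\<lambda>x. complex_of_real (x powr a) * f x)"
proof (cases "a > -1")
  case True
  then show ?thesis
    using e by (intro set_integrable_subset[OF half_integrable_0[OF f True]]) auto
next
  case False
  then have e: "\<epsilon> > 0" and a: "a \<le> 0" using e by auto
  note [measurable] = schwartz_borel_measurable[OF f]
  show ?thesis
    unfolding set_integrable_def
  proof (rule Bochner_Integration.integrable_bound)
    show "integrable lborel (\<lambda>x. \<epsilon> powr a * cmod (f x))"
      using schwartz_integrable[OF f] by (intro integrable_mult_right integrable_norm)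
    show "AE x in lborel. norm (indicator {\<epsilon><..} x *\<^sub>R (complex_of_real (x powr a) * f x))
       \<le> norm (\<epsilon> powr a * cmod (f x))"
      using e a by (intro always_eventually allI)
        (auto simp: norm_mult indicator_def intro!: mult_right_mono powr_mono2')
  qed measurable
qed

lemma half_int_tendsto:
  assumes f: "schwartz f" and a: "a > -1"
  shows "(half_int a f \<longlongrightarrow> half_int a f 0) (at_right 0)"
  unfolding half_int_def set_lebesgue_integral_def
proof (rule integral_dominated_convergence_at_right)
  note [measurable] = schwartz_borel_measurable[OF f]
  let ?g = "\<lambda>x. complex_of_real (x powr a) * f x"
  show "integrable lborel (\<lambda>x. norm (indicator {0<..} x *\<^sub>R ?g x))"
    using half_integrable_0[OF f a] unfolding set_integrable_def by (rule integrable_norm)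
  show "eventually (\<lambda>t. AE x in lborel. norm (indicator {t<..} x *\<^sub>R ?g x) \<le> norm (indicator {0<..} x *\<^sub>R ?g x)) (at_right 0)"
    using eventually_at_right_less[of 0] by eventually_elim (auto simp: indicator_def)
  show "AE x in lborel. ((\<lambda>t. indicator {t<..} x *\<^sub>R ?g x) \<longlongrightarrow> indicator {0<..} x *\<^sub>R ?g x) (at_right 0)"
  proof (rule AE_I2, rule tendsto_eventually)
    fix x :: real
    show "eventually (\<lambda>t. indicator {t<..} x *\<^sub>R ?g x = indicator {0<..} x *\<^sub>R ?g x) (at_right 0)"
    proof (cases "x > 0")
      case True
      then show ?thesis
        unfolding eventually_at_right_field by (intro exI[of _ x]) (auto simp: indicator_def)
    next
      case False
      show ?thesis
        using eventually_at_right_less[of 0] by eventually_elim (use False in \<open>auto simp: indicator_def\<close>)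
    qed
  qed
  show "(\<lambda>x. indicator {0<..} x *\<^sub>R ?g x) \<in> borel_measurable lborel" by measurable
  show "(\<lambda>x. indicator {t<..} x *\<^sub>R ?g x) \<in> borel_measurable lborel" for t by measurable
qed

lemma half_int_cmult: "half_int a (\<lambda>x. c * f x) \<epsilon> = c * half_int a f \<epsilon>"
proof -
  have "half_int a (\<lambda>x. c * f x) \<epsilon> = (LINT x|lborel. c * (indicator {\<epsilon><..} x *\<^sub>R (complex_of_real (x powr a) * f x)))"
    unfolding half_int_def set_lebesgue_integral_def
    by (rule Bochner_Integration.integral_cong) (auto simp: mult_ac)
  then show ?thesis unfolding half_int_def set_lebesgue_integral_def by (simp only: integral_mult_right_zero)
qed

lemma half_int_times_x:
  assumes "\<epsilon> \<ge> 0"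
  shows "half_int a (\<lambda>x. complex_of_real x * f x) \<epsilon> = half_int (a + 1) f \<epsilon>"
  unfolding half_int_def
  by (rule set_lebesgue_integral_cong) (use assms in \<open>auto simp: powr_add\<close>)

lemma schwartz_powr_tendsto_at_top:
  assumes "schwartz f"
  shows "((\<lambda>x. complex_of_real (x powr b) * f x) \<longlongrightarrow> 0) at_top"
proof (rule Lim_null_comparison)
  show "((\<lambda>x. norm (complex_of_real x ^ nat \<lceil>b\<rceil> * f x)) \<longlongrightarrow> 0) at_top"
    using schwartz_tendsto_at_top[OF schwartz_power_mult[OF assms]] by (rule tendsto_norm_zero)
  show "eventually (\<lambda>x. norm (complex_of_real (x powr b) * f x) \<le> norm (complex_of_real x ^ nat \<lceil>b\<rceil> * f x)) at_top"
    using eventually_ge_at_top[of 1]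
    by eventually_elim (use powr_le_power_nat_ceiling in \<open>auto simp: norm_mult norm_power intro!: mult_right_mono\<close>)
qed

text \<open>Integration by parts on (\<epsilon>, infinity): the boundary term at infinity vanishes
  by rapid decay, the one at \<epsilon> remains and has to be analysed by its Taylor
  expansion.\<close>

lemma half_int_vderiv:
  assumes f: "schwartz f" and e: "\<epsilon> > 0"
  shows "half_int b (vderiv f) \<epsilon> = - complex_of_real (\<epsilon> powr b) * f \<epsilon> - complex_of_real b * half_int (b - 1) f \<epsilon>"
proof -
  let ?F = "\<lambda>x. complex_of_real (x powr b) * f x"
  let ?g = "\<lambda>x. complex_of_real (x powr b) * vderiv f x + complex_of_real b * (complex_of_real (x powr (b - 1)) * f x)"
  have int1: "set_integrable lborel {\<epsilon><..} (\<lambda>x. complex_of_real (x powr b) * vderiv f x)"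
    and int2: "set_integrable lborel {\<epsilon><..} (\<lambda>x. complex_of_real b * (complex_of_real (x powr (b - 1)) * f x))"
    using e f by (auto intro!: half_integrable schwartz_vderiv set_integrable_mult_right)
  have ein: "einterval (ereal \<epsilon>) \<infinity> = {\<epsilon><..}" by (auto simp: einterval_def)
  have "(LBINT x=ereal \<epsilon>..\<infinity>. ?g x) = 0 - ?F \<epsilon>"
  proof (rule interval_integral_FTC_integrable[where F = ?F])
    fix x assume "ereal \<epsilon> < ereal x"
    then have x: "x > 0" using e by simp
    have d: "((\<lambda>x. x powr b) has_real_derivative b * x powr (b - 1)) (at x)"
      using x by (auto intro!: derivative_eq_intros simp: powr_diff)
    show "(?F has_vector_derivative ?g x) (at x)"
      by (rule has_vector_derivative_eq_rhs[OF has_vector_derivative_mult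
            [OF has_vector_derivative_of_real[OF d] schwartz_has_vector_derivative[OF f]]]) (simp add: mult.assoc)
    show "isCont ?g x"
      using x by (intro continuous_intros schwartz_isCont f schwartz_vderiv) auto
  next
    show "set_integrable lborel (einterval (ereal \<epsilon>) \<infinity>) ?g"
      unfolding ein using int1 int2 by (rule set_integral_add)
    have "isCont ?F \<epsilon>" using e by (intro continuous_intros schwartz_isCont f) auto
    then show "((?F \<circ> real_of_ereal) \<longlongrightarrow> ?F \<epsilon>) (at_right (ereal \<epsilon>))"
      unfolding ereal_tendsto_simps by (simp add: isCont_def filterlim_at_split)
    show "((?F \<circ> real_of_ereal) \<longlongrightarrow> 0) (at_left \<infinity>)"
      unfolding ereal_tendsto_simps by (rule schwartz_powr_tendsto_at_top[OF f])
  qed simp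
  then have "(LINT x:{\<epsilon><..}|lborel. ?g x) = - ?F \<epsilon>"
    by (simp add: interval_lebesgue_integral_def ein)
  then have "half_int b (vderiv f) \<epsilon> + complex_of_real b * half_int (b - 1) f \<epsilon> = - ?F \<epsilon>"
    by (simp add: half_int_def set_integral_add(2)[OF int1 int2])
  then show ?thesis by (simp add: algebra_simps eq_neg_iff_add_eq_0)
qed

section \<open>Two-sided homogeneous integrals and integration by parts in the finite part\<close>

text \<open>The pairing of A x_+^a + B x_-^a with \<open>f\<close> over |x| > \<epsilon>, the
  negative half-line being folded onto the positive one.\<close>

definition two_sided :: "complex \<Rightarrow> complex \<Rightarrow> real \<Rightarrow> (real \<Rightarrow> complex) \<Rightarrow> real \<Rightarrow> complex" where
  "two_sided A B a f \<epsilon> = A * half_int a f \<epsilon> + B * half_int a (\<lambda>x. f (- x)) \<epsilon>"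

lemma two_sided_tendsto:
  assumes "schwartz f" "a > -1"
  shows "(two_sided A B a f \<longlongrightarrow> two_sided A B a f 0) (at_right 0)"
  unfolding two_sided_def using assms by (intro tendsto_intros half_int_tendsto schwartz_reflect)

lemma two_sided_cmult: "two_sided A B a (\<lambda>x. c * f x) \<epsilon> = c * two_sided A B a f \<epsilon>"
  by (simp add: two_sided_def half_int_cmult algebra_simps)

text \<open>On the folded half-line the factor x becomes -x, which is where the sign of
  \<open>B\<close> changes.\<close>

lemma two_sided_times_x:
  assumes "\<epsilon> \<ge> 0"
  shows "two_sided A B a (\<lambda>x. complex_of_real x * f x) \<epsilon> = two_sided A (- B) (a + 1) f \<epsilon>"
  using half_int_times_x[OF assms, of a f] half_int_times_x[OF assms, of a "\<lambda>x. f (- x)"]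
    half_int_cmult[of a "-1" "\<lambda>x. complex_of_real x * f (- x)" \<epsilon>]
  by (simp add: two_sided_def)

lemma two_sided_vderiv:
  assumes f: "schwartz f" and e: "\<epsilon> > 0"
  shows "two_sided A (- B) b (vderiv f) \<epsilon> =
     - complex_of_real (\<epsilon> powr b) * (A * f \<epsilon> + B * f (- \<epsilon>)) - complex_of_real b * two_sided A B (b - 1) f \<epsilon>"
proof -
  have "half_int b (\<lambda>x. vderiv f (- x)) \<epsilon> =
      complex_of_real (\<epsilon> powr b) * f (- \<epsilon>) + complex_of_real b * half_int (b - 1) (\<lambda>x. f (- x)) \<epsilon>"
    using half_int_vderiv[OF schwartz_reflect[OF f] e, of b] half_int_cmult[of b "-1" "\<lambda>x. vderiv f (- x)" \<epsilon>]
    by (simp add: vderiv_reflect[OF f] algebra_simps)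
  then show ?thesis
    unfolding two_sided_def half_int_vderiv[OF f e] by (simp add: algebra_simps)
qed

text \<open>The derivative of the remainder of f is the remainder of f' of one degree less, so the
  induction passes to f' and integrates its bound by the mean value inequality on the segment from 0
  to x. The bound holds on the whole line.\<close>

lemma schwartz_taylor:
  assumes "schwartz f"
  shows "\<exists>C. \<forall>x. cmod (f x - (\<Sum>j<n. (vderiv ^^ j) f 0 / fact j * complex_of_real x ^ j)) \<le> C * \<bar>x\<bar> ^ n"
  using assms
proof (induction n arbitrary: f)
  case 0
  then obtain C where "\<And>x. \<bar>x\<bar> ^ 0 * cmod (f x) \<le> C" by (metis schwartz_bound)
  then show ?case by auto
next
  case (Suc n)
  let ?R = "\<lambda>x. f x - (\<Sum>j<Suc n. (vderiv ^^ j) f 0 / fact j * complex_of_real x ^ j)"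
  let ?R' = "\<lambda>x. vderiv f x - (\<Sum>j<n. (vderiv ^^ j) (vderiv f) 0 / fact j * complex_of_real x ^ j)"
  obtain C where C: "\<And>x. cmod (?R' x) \<le> C * \<bar>x\<bar> ^ n"
    using Suc.IH[OF schwartz_vderiv[OF Suc.prems]] by blast
  have deriv: "(?R has_vector_derivative ?R' x) (at x)" for x
  proof -
    have "((\<lambda>x. (vderiv ^^ Suc j) f 0 / fact (Suc j) * complex_of_real x ^ Suc j) has_vector_derivative
        (vderiv ^^ j) (vderiv f) 0 / fact j * complex_of_real x ^ j) (at x)" for j
    proof (rule has_vector_derivative_eq_rhs)
      have "((\<lambda>x. x ^ Suc j) has_real_derivative real (Suc j) * x ^ j) (at x)"
        using DERIV_pow[of "Suc j" x] by simp
      from has_vector_derivative_mult_right[OF has_vector_derivative_of_real[OF this],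
          of "(vderiv ^^ Suc j) f 0 / fact (Suc j)"]
      show "((\<lambda>x. (vderiv ^^ Suc j) f 0 / fact (Suc j) * complex_of_real x ^ Suc j) has_vector_derivative
        (vderiv ^^ Suc j) f 0 / fact (Suc j) * complex_of_real (real (Suc j) * x ^ j)) (at x)"
        by (simp only: of_real_power)
      have "(vderiv ^^ j) (vderiv f) = (vderiv ^^ Suc j) f" by (simp add: funpow_swap1)
      then show "(vderiv ^^ Suc j) f 0 / fact (Suc j) * complex_of_real (real (Suc j) * x ^ j)
         = (vderiv ^^ j) (vderiv f) 0 / fact j * complex_of_real x ^ j"
        by (simp add: field_simps del: funpow.simps of_nat_Suc)
    qed
    then have "((\<lambda>x. \<Sum>j<n. (vderiv ^^ Suc j) f 0 / fact (Suc j) * complex_of_real x ^ Suc j) has_vector_derivative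
        (\<Sum>j<n. (vderiv ^^ j) (vderiv f) 0 / fact j * complex_of_real x ^ j)) (at x)"
      by (intro has_vector_derivative_sum)
    from has_vector_derivative_diff[OF has_vector_derivative_diff[OF
          schwartz_has_vector_derivative[OF Suc.prems] has_vector_derivative_const[of "f 0"]] this]
    show ?thesis by (simp add: sum.lessThan_Suc_shift algebra_simps del: sum.lessThan_Suc)
  qed
  have "cmod (?R x) \<le> C * \<bar>x\<bar> ^ Suc n" for x
  proof -
    have "norm (?R x - ?R 0) \<le> (C * \<bar>x\<bar> ^ n) * norm (x - 0)"
    proof (rule differentiable_bound[of "closed_segment 0 x"])
      fix y assume y: "y \<in> closed_segment 0 x"
      then have "\<bar>y\<bar> \<le> \<bar>x\<bar>" by (auto simp: closed_segment_eq_real_ivl split: if_splits)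
      have "C \<ge> 0" using C[of 1] order_trans[OF norm_ge_zero C[of 1]] by simp
      show "(?R has_derivative (\<lambda>h. h *\<^sub>R ?R' y)) (at y within closed_segment 0 x)"
        using deriv[of y] unfolding has_vector_derivative_def by (rule has_derivative_at_withinI)
      have "onorm (\<lambda>h::real. h *\<^sub>R ?R' y) = norm (?R' y)"
        by (simp add: onorm_scaleR_left[OF bounded_linear_ident] onorm_id)
      also have "\<dots> \<le> C * \<bar>y\<bar> ^ n" by (rule C)
      also have "\<dots> \<le> C * \<bar>x\<bar> ^ n"
        using \<open>\<bar>y\<bar> \<le> \<bar>x\<bar>\<close> \<open>C \<ge> 0\<close> by (intro mult_left_mono power_mono) auto
      finally show "onorm (\<lambda>h::real. h *\<^sub>R ?R' y) \<le> C * \<bar>x\<bar> ^ n" .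
    qed auto
    moreover have "?R 0 = 0" by (simp add: sum.lessThan_Suc_shift del: sum.lessThan_Suc)
    ultimately show ?thesis by (simp add: mult_ac del: sum.lessThan_Suc)
  qed
  then show ?case by blast
qed

text \<open>In the Taylor expansion of \<open>f\<close> at \<open>0\<close>, only the term of degree \<open>-b\<close> could contribute a constant.\<close>
lemma has_finite_part_boundary:
  assumes f: "schwartz f" and parity: "\<And>n::nat. b = - real n \<Longrightarrow> A + B * (-1) ^ n = 0"
  shows "has_finite_part (\<lambda>\<epsilon>. complex_of_real (\<epsilon> powr b) * (A * f \<epsilon> + B * f (- \<epsilon>))) 0"
proof -
  \<comment> \<open>Choosing \<open>n > - b\<close> makes the remainder contribution of order
    \<epsilon>^(b + n), which tends to 0. The Taylor terms below \<open>n\<close> give \<epsilon>^(b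
    + j) with coefficient proportional to A + B (-1)^j, and the parity assumption kills the one with
    b + j = 0.\<close>
  obtain n :: nat where n: "real n > - b" using reals_Archimedean2 by blast
  define d where "d = (\<lambda>j. (vderiv ^^ j) f 0 / fact j)"
  define R where "R = (\<lambda>x. f x - (\<Sum>j<n. d j * complex_of_real x ^ j))"
  obtain C where C: "\<And>x. cmod (R x) \<le> C * \<bar>x\<bar> ^ n"
    using schwartz_taylor[OF f, of n] unfolding R_def d_def by blast
  have "has_finite_part (\<lambda>\<epsilon>. (d j * (A + B * (-1) ^ j)) * complex_of_real (\<epsilon> powr (b + real j))) 0" for j
  proof (cases "b + real j = 0")
    case True
    then have "b = - real j" by simp
    then show ?thesis using parity[of j] by (auto intro: has_finite_part_tendsto)
  next
    case False
    from has_finite_part_cmult[OF has_finite_part_powr_0[OF this], of "d j * (A + B * (-1) ^ j)"]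
    show ?thesis by simp
  qed
  then have "has_finite_part (\<lambda>\<epsilon>. \<Sum>j<n. (d j * (A + B * (-1) ^ j)) * complex_of_real (\<epsilon> powr (b + real j))) (\<Sum>j<n. 0)"
    by (intro has_finite_part_sum)
  moreover have "((\<lambda>\<epsilon>. complex_of_real (\<epsilon> powr b) * (A * R \<epsilon> + B * R (- \<epsilon>))) \<longlongrightarrow> 0) (at_right 0)"
  proof (rule Lim_null_comparison)
    have "b + real n > 0" using n by simp
    then have "((\<lambda>\<epsilon>::real. \<epsilon> powr (b + real n)) \<longlongrightarrow> 0) (at_right 0)" by real_asymp
    from tendsto_mult_left[OF this, of "(cmod A + cmod B) * C"]
    show "((\<lambda>\<epsilon>. ((cmod A + cmod B) * C) * \<epsilon> powr (b + real n)) \<longlongrightarrow> 0) (at_right 0)" by simp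
    show "eventually (\<lambda>\<epsilon>. norm (complex_of_real (\<epsilon> powr b) * (A * R \<epsilon> + B * R (- \<epsilon>)))
        \<le> ((cmod A + cmod B) * C) * \<epsilon> powr (b + real n)) (at_right 0)"
      using eventually_at_right_less[of 0]
    proof eventually_elim
      case (elim \<epsilon>)
      have "norm (A * R \<epsilon> + B * R (- \<epsilon>)) \<le> cmod A * (C * \<bar>\<epsilon>\<bar> ^ n) + cmod B * (C * \<bar>-\<epsilon>\<bar> ^ n)"
        by (rule order_trans[OF norm_triangle_ineq], unfold norm_mult)
          (intro add_mono mult_left_mono C norm_ge_zero)
      then have "\<epsilon> powr b * norm (A * R \<epsilon> + B * R (- \<epsilon>)) \<le> \<epsilon> powr b * (cmod A * (C * \<bar>\<epsilon>\<bar> ^ n) + cmod B * (C * \<bar>-\<epsilon>\<bar> ^ n))"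
        by (rule mult_left_mono) simp
      also have "\<dots> = ((cmod A + cmod B) * C) * \<epsilon> powr (b + real n)"
        using elim by (simp add: powr_add powr_realpow algebra_simps)
      finally show ?case by (simp add: norm_mult)
    qed
  qed
  ultimately have "has_finite_part (\<lambda>\<epsilon>. (\<Sum>j<n. (d j * (A + B * (-1) ^ j)) * complex_of_real (\<epsilon> powr (b + real j)))
      + complex_of_real (\<epsilon> powr b) * (A * R \<epsilon> + B * R (- \<epsilon>))) 0"
    using has_finite_part_add[OF _ has_finite_part_tendsto] by fastforce
  then show ?thesis
  proof (rule has_finite_part_cong)
    show "eventually (\<lambda>\<epsilon>. (\<Sum>j<n. (d j * (A + B * (-1) ^ j)) * complex_of_real (\<epsilon> powr (b + real j)))
      + complex_of_real (\<epsilon> powr b) * (A * R \<epsilon> + B * R (- \<epsilon>)) = complex_of_real (\<epsilon> powr b) * (A * f \<epsilon> + B * f (- \<epsilon>))) (at_right 0)"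
      using eventually_at_right_less[of 0]
    proof eventually_elim
      case (elim \<epsilon>)
      let ?p = "complex_of_real (\<epsilon> powr b)"
      have "(\<Sum>j<n. (d j * (A + B * (-1) ^ j)) * complex_of_real (\<epsilon> powr (b + real j)))
         = ?p * (A * (\<Sum>j<n. d j * complex_of_real \<epsilon> ^ j) + B * (\<Sum>j<n. d j * complex_of_real (- \<epsilon>) ^ j))"
        unfolding sum_distrib_left sum.distrib[symmetric]
      proof (rule sum.cong)
        fix j
        have "complex_of_real (- \<epsilon>) ^ j = (-1) ^ j * complex_of_real \<epsilon> ^ j"
          by (simp add: power_minus[of "complex_of_real \<epsilon>"])
        then show "d j * (A + B * (- 1) ^ j) * complex_of_real (\<epsilon> powr (b + real j)) =
           ?p * (A * (d j * complex_of_real \<epsilon> ^ j) + B * (d j * complex_of_real (- \<epsilon>) ^ j))"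
          using elim by (simp add: powr_add powr_realpow algebra_simps)
      qed simp
      then show ?case by (simp add: R_def algebra_simps)
    qed
  qed
qed

text \<open>The integration by parts formula is solved for the integral with exponent
  \<open>b - 1\<close>; the boundary expression has finite part 0, and the division forces
  \<open>b\<close> to be nonzero.\<close>

lemma has_finite_part_two_sided_vderiv:
  assumes f: "schwartz f" and "b \<noteq> 0" and "\<And>n::nat. b = - real n \<Longrightarrow> A + B * (-1) ^ n = 0"
    and c: "has_finite_part (two_sided A (- B) b (vderiv f)) c"
  shows "has_finite_part (two_sided A B (b - 1) f) (- c / complex_of_real b)"
proof -
  let ?g = "\<lambda>\<epsilon>. complex_of_real (\<epsilon> powr b) * (A * f \<epsilon> + B * f (- \<epsilon>))"
  have "has_finite_part (\<lambda>\<epsilon>. (- 1 / complex_of_real b) * (two_sided A (- B) b (vderiv f) \<epsilon> + ?g \<epsilon>))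
     ((- 1 / complex_of_real b) * (c + 0))"
    using assms by (intro has_finite_part_cmult has_finite_part_add has_finite_part_boundary)
  then have "has_finite_part (two_sided A B (b - 1) f) ((- 1 / complex_of_real b) * (c + 0))"
  proof (rule has_finite_part_cong)
    show "eventually (\<lambda>\<epsilon>. (- 1 / complex_of_real b) * (two_sided A (- B) b (vderiv f) \<epsilon> + ?g \<epsilon>)
       = two_sided A B (b - 1) f \<epsilon>) (at_right 0)"
      using eventually_at_right_less[of 0]
      by eventually_elim (use \<open>b \<noteq> 0\<close> in \<open>simp add: two_sided_vderiv[OF f]\<close>)
  qed
  then show ?thesis by simp
qed

lemma has_finite_part_two_sided_cmult:
  "has_finite_part (two_sided A B a f) c \<Longrightarrow> has_finite_part (two_sided A B a (\<lambda>x. z * f x)) (z * c)"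
  by (rule has_finite_part_cong[OF has_finite_part_cmult]) (auto simp: two_sided_cmult intro: always_eventually)

lemma has_finite_part_two_sided_times_x:
  "has_finite_part (two_sided A B a (\<lambda>x. complex_of_real x * f x)) c
    \<longleftrightarrow> has_finite_part (two_sided A (- B) (a + 1) f) c"
proof -
  have "eventually (\<lambda>\<epsilon>. two_sided A B a (\<lambda>x. complex_of_real x * f x) \<epsilon> = two_sided A (- B) (a + 1) f \<epsilon>) (at_right 0)"
    using eventually_at_right_less[of 0] by eventually_elim (simp add: two_sided_times_x)
  then show ?thesis
    by (auto elim: has_finite_part_cong simp: eq_commute)
qed

section \<open>The Fourier transform of a damped power\<close>

lemma set_integral_abs_greater_split:
  fixes h :: "real \<Rightarrow> complex"
  assumes "\<epsilon> \<ge> 0" and pos: "set_integrable lborel {\<epsilon><..} h" and neg: "set_integrable lborel {\<epsilon><..} (\<lambda>x. h (- x))"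
  shows "set_integrable lborel {x. \<epsilon> < \<bar>x\<bar>} h"
    and "(LINT x:{x. \<epsilon> < \<bar>x\<bar>}|lborel. h x) = (LINT x:{\<epsilon><..}|lborel. h x) + (LINT x:{\<epsilon><..}|lborel. h (- x))"
proof -
  have set: "{x. \<epsilon> < \<bar>x\<bar>} = {\<epsilon><..} \<union> {..< -\<epsilon>}" and disj: "{\<epsilon><..} \<inter> {..< -\<epsilon>} = {}"
    using assms(1) by auto
  have neg': "set_integrable lborel {..< -\<epsilon>} h"
    using lborel_integrable_real_affine[OF neg[unfolded set_integrable_def], of "-1" 0]
    unfolding set_integrable_def by (simp add: indicator_def minus_less_iff less_minus_iff)
  show "set_integrable lborel {x. \<epsilon> < \<bar>x\<bar>} h"
    unfolding set using pos neg' by (intro set_integrable_Un) auto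
  have "(LINT x:{..< -\<epsilon>}|lborel. h x) = (LINT x:{\<epsilon><..}|lborel. h (- x))"
    using set_integral_reflect[of "{..< -\<epsilon>}" h] by (simp add: greaterThan_def)
  then show "(LINT x:{x. \<epsilon> < \<bar>x\<bar>}|lborel. h x) = (LINT x:{\<epsilon><..}|lborel. h x) + (LINT x:{\<epsilon><..}|lborel. h (- x))"
    unfolding set by (simp add: set_integral_Un[OF disj pos neg'])
qed

lemma integral_split_at_0:
  fixes h :: "real \<Rightarrow> complex"
  assumes [measurable]: "h \<in> borel_measurable borel"
    and pos: "set_integrable lborel {0<..} h" and neg: "set_integrable lborel {0<..} (\<lambda>x. h (- x))"
  shows "integrable lborel h"
    and "(LINT x|lborel. h x) = (LINT x:{0<..}|lborel. h x) + (LINT x:{0<..}|lborel. h (- x))"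
proof -
  note split = set_integral_abs_greater_split[OF order_refl pos neg]
  have AE: "AE x in lborel. indicator {x. 0 < \<bar>x\<bar>} x *\<^sub>R h x = h x"
    using AE_lborel_singleton[of "0::real"] by eventually_elim (auto simp: indicator_def)
  show "integrable lborel h"
    using split(1) integrable_cong_AE[OF _ _ AE] unfolding set_integrable_def by simp
  show "(LINT x|lborel. h x) = (LINT x:{0<..}|lborel. h x) + (LINT x:{0<..}|lborel. h (- x))"
    using split(2) integral_cong_AE[OF _ _ AE] unfolding set_lebesgue_integral_def by simp
qed

text \<open>Damping the power by an exponential makes it integrable, with a Fourier transform
  that solves a first-order linear differential equation.\<close>
definition damped_power :: "real \<Rightarrow> real \<Rightarrow> real \<Rightarrow> complex" where
  "damped_power s a k = complex_of_real (indicator {0<..} k * (k powr a * exp (- (s * k))))"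

lemma damped_power_measurable [measurable]: "damped_power s a \<in> borel_measurable borel"
  unfolding damped_power_def by measurable

lemma damped_power_integrable:
  assumes "a > -1" "s > 0"
  shows "integrable lborel (damped_power s a)"
proof -
  have "(\<lambda>t. complex_of_real t powr (complex_of_real (a + 1) - 1) / of_real (exp (s * t))) absolutely_integrable_on {0<..}"
    using assms by (intro absolutely_integrable_Gamma_integral) auto
  then have "integrable lebesgue (damped_power s a)"
    unfolding set_integrable_def
    by (rule Bochner_Integration.integrable_cong[THEN iffD1, rotated 2])
      (auto simp: damped_power_def indicator_def powr_of_real exp_minus field_simps)
  then show ?thesis by (simp add: integrable_completion)
qed

lemma damped_power_times: "complex_of_real k * damped_power s a k = damped_power s (a + 1) k"
proof (cases "k > 0")
  case True
  then have "k * (k powr a * exp (- (s * k))) = k powr (a + 1) * exp (- (s * k))"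
    by (simp only: mult.assoc[symmetric] powr_mult_base[OF less_imp_le] add.commute[of a])
  with True show ?thesis by (simp add: damped_power_def flip: of_real_mult)
qed (simp add: damped_power_def)

lemma fourier_damped_power_deriv:
  assumes "a > -1" "s > 0"
  shows "(fourier (damped_power s a) has_vector_derivative - \<i> * fourier (damped_power s (a + 1)) x) (at x)"
proof -
  have sq: "complex_of_real (k\<^sup>2) * damped_power s a k = damped_power s (a + 2) k" for k
    using damped_power_times[of k s "a + 1"] damped_power_times[of k s a]
    by (simp add: power2_eq_square mult.assoc add.commute)
  have "(fourier (damped_power s a) has_vector_derivative
      fourier (\<lambda>k. - \<i> * (complex_of_real k * damped_power s a k)) x) (at x)"
    using assms by (intro fourier_has_vector_derivative) (simp_all only: sq, auto intro!: damped_power_integrable)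
  then show ?thesis
    using assms damped_power_integrable[of "a + 1" s] fourier_cmult[of "damped_power s (a + 1)" "- \<i>" x]
    by (simp add: damped_power_times)
qed

text \<open>Integrate the derivative of k^(a+1) e^(-zk), z = s + ix, over the positive half-line: it
  vanishes at 0 because a + 1 > 0 and at infinity because s > 0. Together with the derivative
  formula this is the differential equation (s + ix) G' = -i (a + 1) G for the transform G.\<close>

lemma fourier_damped_power_parts:
  assumes a: "a > -1" and s: "s > 0"
  shows "(complex_of_real s + \<i> * complex_of_real x) * fourier (damped_power s (a + 1)) x
     = complex_of_real (a + 1) * fourier (damped_power s a) x"
proof -
  define z where "z = complex_of_real s + \<i> * complex_of_real x"
  let ?F = "\<lambda>k. complex_of_real (k powr (a + 1)) * exp (- z * complex_of_real k)"
  let ?p = "\<lambda>b k. complex_of_real (k powr b) * exp (- z * complex_of_real k)"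
  let ?g = "\<lambda>k. complex_of_real (a + 1) * ?p a k - z * ?p (a + 1) k"
  have conv: "indicator {0<..} k *\<^sub>R ?p b k = damped_power s b k * exp (- \<i> * complex_of_real (x * k))" for b k
  proof -
    have "exp (- z * complex_of_real k) = complex_of_real (exp (- (s * k))) * exp (- \<i> * complex_of_real (x * k))"
      by (simp add: z_def exp_of_real[symmetric] exp_add[symmetric] algebra_simps)
    then show ?thesis by (simp add: damped_power_def indicator_def)
  qed
  have int: "set_integrable lborel {0<..} (?p b)" and val: "(LINT k:{0<..}|lborel. ?p b k) = fourier (damped_power s b) x"
    if "b > -1" for b
    using fourier_eq_lborel[OF damped_power_integrable[OF that s], of x]
    unfolding set_integrable_def set_lebesgue_integral_def conv by simp_all
  have i1: "set_integrable lborel {0<..} (\<lambda>k. complex_of_real (a + 1) * ?p a k)"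
    and i2: "set_integrable lborel {0<..} (\<lambda>k. z * ?p (a + 1) k)"
    by (rule set_integrable_mult_right, rule int, use a in simp)+
  have ein: "einterval (ereal 0) \<infinity> = {0<..}" by (auto simp: einterval_def)
  have nF: "cmod (?F k) = k powr (a + 1) * exp (- (s * k))" for k
    by (simp add: norm_mult z_def)
  have "(LBINT k=ereal 0..\<infinity>. ?g k) = 0 - 0"
  proof (rule interval_integral_FTC_integrable[where F = ?F])
    fix k assume "ereal 0 < ereal k"
    then have k: "k > 0" by simp
    have d: "((\<lambda>k. k powr (a + 1)) has_real_derivative (a + 1) * k powr a) (at k)"
      using has_real_derivative_powr[OF k, of "a + 1"] by simp
    have e: "((\<lambda>k. exp (- z * complex_of_real k)) has_vector_derivative - z * exp (- z * complex_of_real k)) (at k)"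
      by (auto intro!: derivative_eq_intros has_vector_derivative_real_field)
    show "(?F has_vector_derivative ?g k) (at k)"
      by (rule has_vector_derivative_eq_rhs[OF has_vector_derivative_mult[OF has_vector_derivative_of_real[OF d] e]])
        (simp add: mult_ac)
    show "isCont ?g k" using k by (intro continuous_intros) auto
  next
    show "set_integrable lborel (einterval (ereal 0) \<infinity>) ?g"
      unfolding ein using i1 i2 by (rule set_integral_diff)
    show "((?F \<circ> real_of_ereal) \<longlongrightarrow> 0) (at_right (ereal 0))"
      unfolding ereal_tendsto_simps
    proof (rule tendsto_norm_zero_cancel, unfold nF)
      have "a + 1 > 0" using a by simp
      then show "((\<lambda>k. k powr (a + 1) * exp (- (s * k))) \<longlongrightarrow> 0) (at_right 0)" by real_asymp
    qed
    show "((?F \<circ> real_of_ereal) \<longlongrightarrow> 0) (at_left \<infinity>)"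
      unfolding ereal_tendsto_simps
    proof (rule tendsto_norm_zero_cancel, unfold nF)
      show "((\<lambda>k. k powr (a + 1) * exp (- (s * k))) \<longlongrightarrow> 0) at_top" using s by real_asymp
    qed
  qed simp
  then have "(LINT k:{0<..}|lborel. ?g k) = 0"
    unfolding interval_lebesgue_integral_def ein by simp
  moreover have "(LINT k:{0<..}|lborel. ?g k) = complex_of_real (a + 1) * (LINT k:{0<..}|lborel. ?p a k)
      - z * (LINT k:{0<..}|lborel. ?p (a + 1) k)"
    by (simp only: set_integral_diff(2)[OF i1 i2] set_integral_mult_right)
  moreover have "a + 1 > -1" using a by simp
  ultimately show ?thesis
    unfolding z_def[symmetric] by (simp only: val[OF a] val[of "a + 1"]) simp
qed

text \<open>The initial value for that equation: Euler's integral at s = 1, rescaled by t = s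
  k.\<close>

lemma fourier_damped_power_0:
  assumes a: "a > -1" and s: "s > 0"
  shows "fourier (damped_power s a) 0 = complex_of_real (Gamma (a + 1) * s powr (- (a + 1)))"
proof -
  have "((\<lambda>t. t powr (a + 1 - 1) / exp t) has_integral Gamma (a + 1)) {0..}"
    using a by (intro Gamma_integral_real) simp
  then have "((\<lambda>t. if t \<in> {0..} then t powr a / exp t else 0) has_integral Gamma (a + 1)) UNIV"
    unfolding has_integral_restrict_UNIV by simp
  then have "((\<lambda>t. indicator {0<..} t * (t powr a * exp (- t))) has_integral Gamma (a + 1)) UNIV"
    by (rule has_integral_spike[OF negligible_sing[of 0], rotated])
      (auto simp: indicator_def exp_minus field_simps)
  from has_integral_of_real[OF this, where ?'b = complex]
  have "(damped_power 1 a has_integral complex_of_real (Gamma (a + 1))) UNIV"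
    unfolding damped_power_def by simp
  then have "(LINT k|lborel. damped_power 1 a k) = complex_of_real (Gamma (a + 1))"
    using has_integral_integral_lborel[OF damped_power_integrable[OF a zero_less_one]] has_integral_unique by blast
  moreover have "damped_power 1 a (0 + s * k) = complex_of_real (s powr a) * damped_power s a k" for k
    using s by (simp add: damped_power_def indicator_def powr_mult zero_less_mult_iff)
  ultimately have "complex_of_real (Gamma (a + 1)) = s *\<^sub>R (complex_of_real (s powr a) * (LINT k|lborel. damped_power s a k))"
    using lborel_integral_real_affine[of s "damped_power 1 a" 0] s by simp
  moreover have "fourier (damped_power s a) 0 = (LINT k|lborel. damped_power s a k)"
    using fourier_eq_lborel(1)[OF damped_power_integrable[OF a s], of 0] by simp
  moreover have "s * s powr a * s powr (- (a + 1)) = 1"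
    using s powr_add[of s a 1] powr_add[of s "a + 1" "- (a + 1)"] by (simp add: mult.commute)
  then have "complex_of_real s * complex_of_real (s powr a) * complex_of_real (s powr (- (a + 1))) = 1"
    by (simp only: of_real_mult[symmetric] of_real_1)
  ultimately show ?thesis
    by (simp add: scaleR_conv_of_real mult_ac)
qed

text \<open>By the differential equation, z^(a+1) G is constant, and the value at x = 0 identifies
  the constant as \<Gamma>(a+1). Since Re z = s > 0, the path z = s + ix avoids the cut of
  \<open>Ln\<close>, so the principal branch is differentiable along it.\<close>

lemma fourier_damped_power:
  assumes a: "a > -1" and s: "s > 0"
  shows "fourier (damped_power s a) x = complex_of_real (Gamma (a + 1))
     * exp (- complex_of_real (a + 1) * Ln (complex_of_real s + \<i> * complex_of_real x))"
proof -
  define z where "z = (\<lambda>x. complex_of_real s + \<i> * complex_of_real x)"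
  define W where "W = (\<lambda>x. exp (complex_of_real (a + 1) * Ln (z x)))"
  let ?G = "fourier (damped_power s a)"
  have z0: "z x \<noteq> 0" "z x \<notin> \<real>\<^sub>\<le>\<^sub>0" for x
    using s by (auto simp: z_def complex_eq_iff complex_nonpos_Reals_iff)
  have "((\<lambda>x. W x * ?G x) has_vector_derivative 0) (at x)" for x
  proof -
    have zd: "(z has_vector_derivative \<i>) (at x)"
      unfolding z_def by (auto intro!: derivative_eq_intros has_vector_derivative_real_field)
    have "((\<lambda>w. exp (complex_of_real (a + 1) * Ln w)) has_field_derivative
        W x * (complex_of_real (a + 1) * inverse (z x))) (at (z x))"
      unfolding W_def using z0[of x] by (auto intro!: derivative_eq_intros simp: divide_inverse)
    from field_vector_diff_chain_at[OF zd this]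
    have "(W has_vector_derivative \<i> * (W x * (complex_of_real (a + 1) * inverse (z x)))) (at x)"
      by (simp add: W_def o_def)
    from has_vector_derivative_mult[OF this fourier_damped_power_deriv[OF a s]]
    show ?thesis
    proof (rule has_vector_derivative_eq_rhs)
      have G1: "fourier (damped_power s (a + 1)) x = complex_of_real (a + 1) * ?G x / z x"
        using fourier_damped_power_parts[OF a s, of x] z0(1)[of x] by (simp add: z_def field_simps)
      show "W x * (- \<i> * fourier (damped_power s (a + 1)) x)
          + \<i> * (W x * (complex_of_real (a + 1) * inverse (z x))) * ?G x = 0"
        unfolding G1 by (simp add: divide_inverse algebra_simps)
    qed
  qed
  then obtain c where "\<And>x. x \<in> UNIV \<Longrightarrow> W x * ?G x = c"
    by (rule has_vector_derivative_zero_constant[OF convex_UNIV]) (rule that, blast)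
  then have "W x * ?G x = W 0 * ?G 0" by simp
  moreover have "W 0 = complex_of_real (s powr (a + 1))"
    using s by (simp add: W_def z_def powr_def Ln_of_real exp_of_real[symmetric] del: exp_of_real)
  moreover have "complex_of_real (s powr (a + 1)) * complex_of_real (s powr (- (a + 1))) = 1"
    using s by (simp add: powr_add[symmetric] flip: of_real_mult)
  ultimately have WG: "W x * ?G x = complex_of_real (Gamma (a + 1))"
    by (simp add: fourier_damped_power_0[OF a s] mult_ac)
  have "exp (- complex_of_real (a + 1) * Ln (z x)) * W x = 1"
    unfolding W_def mult_minus_left exp_minus by simp
  then have "?G x = exp (- complex_of_real (a + 1) * Ln (z x)) * W x * ?G x" by simp
  also have "\<dots> = complex_of_real (Gamma (a + 1)) * exp (- complex_of_real (a + 1) * Ln (z x))"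
    by (subst mult.assoc, subst WG, rule mult.commute)
  finally show ?thesis unfolding z_def .
qed

section \<open>The exponents in (-1, 0) and the exponent -1\<close>

lemma schwartz_abs_powr_integrable:
  assumes f: "schwartz f" and a: "a > -1"
  shows "integrable lborel (\<lambda>x. complex_of_real (\<bar>x\<bar> powr a) * f x)"
proof (rule integral_split_at_0(1))
  note [measurable] = schwartz_borel_measurable[OF f]
  show "(\<lambda>x. complex_of_real (\<bar>x\<bar> powr a) * f x) \<in> borel_measurable borel" by measurable
  show "set_integrable lborel {0<..} (\<lambda>x. complex_of_real (\<bar>x\<bar> powr a) * f x)"
    using half_integrable_0[OF f a] by (rule set_integrable_cong[THEN iffD1, rotated 3]) auto
  show "set_integrable lborel {0<..} (\<lambda>x. complex_of_real (\<bar>- x\<bar> powr a) * f (- x))"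
    using half_integrable_0[OF schwartz_reflect[OF f] a]
    by (rule set_integrable_cong[THEN iffD1, rotated 3]) auto
qed

text \<open>The arguments pi/2 and -pi/2 of the two imaginary half-axes are the source of the phases
  in the transform once the damping is removed.\<close>

lemma exp_Ln_imaginary:
  assumes "x > 0"
  shows "exp (complex_of_real b * Ln (\<i> * complex_of_real x)) = cis (pi / 2 * b) * complex_of_real (x powr b)"
    and "exp (complex_of_real b * Ln (- (\<i> * complex_of_real x))) = cis (- (pi / 2 * b)) * complex_of_real (x powr b)"
proof -
  have 1: "Ln (\<i> * complex_of_real x) = complex_of_real (ln x) + \<i> * complex_of_real (pi / 2)"
    using Ln_times_of_real[of x \<i>] assms by (simp add: mult.commute Ln_of_real)
  have 2: "Ln (- (\<i> * complex_of_real x)) = complex_of_real (ln x) - \<i> * complex_of_real (pi / 2)"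
    using Ln_times_of_real[of x "- \<i>"] assms by (simp add: mult.commute Ln_of_real)
  have p: "complex_of_real (x powr b) = exp (complex_of_real (b * ln x))"
    using assms by (simp only: powr_def exp_of_real) simp
  show "exp (complex_of_real b * Ln (\<i> * complex_of_real x)) = cis (pi / 2 * b) * complex_of_real (x powr b)"
    unfolding 1 p cis_conv_exp exp_add[symmetric] by (simp add: algebra_simps)
  show "exp (complex_of_real b * Ln (- (\<i> * complex_of_real x))) = cis (- (pi / 2 * b)) * complex_of_real (x powr b)"
    unfolding 2 p cis_conv_exp exp_add[symmetric] by (simp add: algebra_simps)
qed

lemma norm_exp_real_times_Ln:
  assumes "z \<noteq> 0"
  shows "cmod (exp (complex_of_real b * Ln z)) = cmod z powr b"
  using assms by (simp add: powr_def)

text \<open>The range -1 < a < 0 is exactly the one preserved by a -> -a - 1, so the powers on both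
  sides are locally integrable.\<close>

lemma half_int_fourier:
  assumes f: "schwartz f" and a: "-1 < a" "a < 0"
  shows "half_int a (fourier f) 0 = complex_of_real (Gamma (a + 1)) *
     (cis (- (pi / 2 * (a + 1))) * half_int (- a - 1) f 0
      + cis (pi / 2 * (a + 1)) * half_int (- a - 1) (\<lambda>x. f (- x)) 0)"
proof -
  note [measurable] = schwartz_borel_measurable[OF f] schwartz_borel_measurable[OF schwartz_fourier[OF f]]
  define b where "b = - a - 1"
  have b: "-1 < b" "b < 0" "a + 1 = - b" using a by (auto simp: b_def)
  let ?L = "\<lambda>s. LINT k|lborel. damped_power s a k * fourier f k"
  let ?h = "\<lambda>s x. exp (complex_of_real b * Ln (complex_of_real s + \<i> * complex_of_real x)) * f x"
  have ev: "eventually (\<lambda>s. ?L s = complex_of_real (Gamma (a + 1)) * (LINT x|lborel. ?h s x)) (at_right 0)"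
    using eventually_at_right_less[of 0]
  proof eventually_elim
    case (elim s)
    have "?L s = (LINT x|lborel. fourier (damped_power s a) x * f x)"
      using a elim f by (intro fourier_multiplication_formula damped_power_integrable schwartz_integrable)
    also have "\<dots> = (LINT x|lborel. complex_of_real (Gamma (a + 1)) * ?h s x)"
      using fourier_damped_power[OF a(1) elim] by (simp add: b mult.assoc)
    finally show ?case by simp
  qed
  have lim1: "(?L \<longlongrightarrow> half_int a (fourier f) 0) (at_right 0)"
    unfolding half_int_def set_lebesgue_integral_def
  proof (rule integral_dominated_convergence_at_right)
    let ?g = "\<lambda>k. indicator {0<..} k *\<^sub>R (complex_of_real (k powr a) * fourier f k)"
    show "integrable lborel (\<lambda>k. norm (?g k))"
      using half_integrable_0[OF schwartz_fourier[OF f] a(1)] unfolding set_integrable_def by (rule integrable_norm)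
    show "?g \<in> borel_measurable lborel" by measurable
    show "(\<lambda>k. damped_power s a k * fourier f k) \<in> borel_measurable lborel" for s by measurable
    show "AE k in lborel. ((\<lambda>s. damped_power s a k * fourier f k) \<longlongrightarrow> ?g k) (at_right 0)"
    proof (rule AE_I2)
      fix k :: real
      have "((\<lambda>s. indicator {0<..} k * (k powr a * exp (- (s * k)))) \<longlongrightarrow> indicator {0<..} k * (k powr a * exp (- (0 * k)))) (at_right 0)"
        by (intro tendsto_intros)
      then have "((\<lambda>s. damped_power s a k * fourier f k) \<longlongrightarrow>
          complex_of_real (indicator {0<..} k * (k powr a * exp (- (0 * k)))) * fourier f k) (at_right 0)"
        unfolding damped_power_def by (intro tendsto_intros)
      then show "((\<lambda>s. damped_power s a k * fourier f k) \<longlongrightarrow> ?g k) (at_right 0)"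
        by (simp add: scaleR_conv_of_real mult.assoc)
    qed
    show "eventually (\<lambda>s. AE k in lborel. norm (damped_power s a k * fourier f k) \<le> norm (?g k)) (at_right 0)"
      using eventually_at_right_less[of 0]
    proof eventually_elim
      case (elim s)
      then show ?case
        by (intro AE_I2) (auto simp: damped_power_def indicator_def norm_mult intro!: mult_left_le_one_le)
    qed
  qed
  have "((\<lambda>s. LINT x|lborel. ?h s x) \<longlongrightarrow> (LINT x|lborel. ?h 0 x)) (at_right 0)"
  proof (rule integral_dominated_convergence_at_right)
    \<comment> \<open>Because |s + ix| >= |x| and b < 0, the undamped |x|^b dominates for every s >
      0; the origin, where this comparison breaks down, is a null set.\<close>
    show "integrable lborel (\<lambda>x. norm (complex_of_real (\<bar>x\<bar> powr b) * f x))"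
      using schwartz_abs_powr_integrable[OF f b(1)] by (rule integrable_norm)
    show "?h 0 \<in> borel_measurable lborel" by measurable
    show "?h s \<in> borel_measurable lborel" for s by measurable
    show "AE x in lborel. ((\<lambda>s. ?h s x) \<longlongrightarrow> ?h 0 x) (at_right 0)"
      using AE_lborel_singleton[of "0::real"]
    proof eventually_elim
      case (elim x)
      then have "complex_of_real 0 + \<i> * complex_of_real x \<notin> \<real>\<^sub>\<le>\<^sub>0"
        by (auto simp: complex_nonpos_Reals_iff)
      then show ?case by (intro tendsto_intros)
    qed
    show "eventually (\<lambda>s. AE x in lborel. norm (?h s x) \<le> norm (complex_of_real (\<bar>x\<bar> powr b) * f x)) (at_right 0)"
      using eventually_at_right_less[of 0]
    proof eventually_elim
      case (elim s)
      show ?case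
        using AE_lborel_singleton[of "0::real"]
      proof eventually_elim
        case (elim x)
        let ?z = "complex_of_real s + \<i> * complex_of_real x"
        have "?z \<noteq> 0" using elim by (simp add: complex_eq_iff)
        moreover have "\<bar>x\<bar> \<le> cmod ?z" using abs_Im_le_cmod[of ?z] by simp
        then have "cmod ?z powr b \<le> \<bar>x\<bar> powr b" using elim b by (intro powr_mono2') auto
        ultimately show ?case by (simp add: norm_mult norm_exp_real_times_Ln mult_right_mono del: norm_exp_eq_Re)
      qed
    qed
  qed
  then have lim2: "((\<lambda>s. complex_of_real (Gamma (a + 1)) * (LINT x|lborel. ?h s x)) \<longlongrightarrow>
      complex_of_real (Gamma (a + 1)) * (LINT x|lborel. ?h 0 x)) (at_right 0)"
    by (rule tendsto_mult_left)
  have "half_int a (fourier f) 0 = complex_of_real (Gamma (a + 1)) * (LINT x|lborel. ?h 0 x)"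
    by (rule tendsto_unique[OF trivial_limit_at_right_real Lim_transform_eventually[OF lim1 ev] lim2])
  also have "(LINT x|lborel. ?h 0 x) = (LINT x:{0<..}|lborel. ?h 0 x) + (LINT x:{0<..}|lborel. ?h 0 (- x))"
  proof (rule integral_split_at_0(2))
    show "?h 0 \<in> borel_measurable borel" by measurable
    have "set_integrable lborel {0<..} (\<lambda>x. cis (pi / 2 * b) * (complex_of_real (x powr b) * f x))"
      using half_integrable_0[OF f b(1)] by (rule set_integrable_mult_right)
    then show "set_integrable lborel {0<..} (?h 0)"
      by (rule set_integrable_cong[THEN iffD1, rotated 3]) (auto simp: exp_Ln_imaginary)
    have "set_integrable lborel {0<..} (\<lambda>x. cis (- (pi / 2 * b)) * (complex_of_real (x powr b) * f (- x)))"
      using half_integrable_0[OF schwartz_reflect[OF f] b(1)] by (rule set_integrable_mult_right)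
    then show "set_integrable lborel {0<..} (\<lambda>x. ?h 0 (- x))"
      by (rule set_integrable_cong[THEN iffD1, rotated 3]) (auto simp: exp_Ln_imaginary)
  qed
  also have "(LINT x:{0<..}|lborel. ?h 0 x) = (LINT x:{0<..}|lborel. cis (pi / 2 * b) * (complex_of_real (x powr b) * f x))"
    by (rule set_lebesgue_integral_cong) (auto simp: exp_Ln_imaginary)
  also have "(LINT x:{0<..}|lborel. ?h 0 (- x)) = (LINT x:{0<..}|lborel. cis (- (pi / 2 * b)) * (complex_of_real (x powr b) * f (- x)))"
    by (rule set_lebesgue_integral_cong) (auto simp: exp_Ln_imaginary)
  finally show ?thesis
    by (simp only: set_integral_mult_right half_int_def b_def[symmetric] b(3)) simp
qed

section \<open>The exponent -1: the truncated reciprocal and the sine integral\<close>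

text \<open>Two cutoffs are required for integrability, since 1/k fails to be integrable both at 0
  and at infinity.\<close>

definition cutoff_inverse :: "real \<Rightarrow> real \<Rightarrow> real \<Rightarrow> complex" where
  "cutoff_inverse \<epsilon> R k = complex_of_real (indicator {k. \<epsilon> < \<bar>k\<bar> \<and> \<bar>k\<bar> < R} k / k)"

lemma cutoff_inverse_measurable [measurable]: "cutoff_inverse \<epsilon> R \<in> borel_measurable borel"
  unfolding cutoff_inverse_def by measurable

lemma cutoff_inverse_integrable:
  assumes "\<epsilon> > 0"
  shows "integrable lborel (cutoff_inverse \<epsilon> R)"
proof (rule Bochner_Integration.integrable_bound)
  show "integrable lborel (\<lambda>k. indicator {-R..R} k * (1 / \<epsilon>) :: real)"
    by (intro integrable_mult_left integrable_real_indicator) (auto simp: emeasure_lborel_Icc_eq)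
  show "AE k in lborel. norm (cutoff_inverse \<epsilon> R k) \<le> norm (indicator {-R..R} k * (1 / \<epsilon>) :: real)"
    using assms by (intro AE_I2) (auto simp: cutoff_inverse_def indicator_def norm_divide field_simps)
qed measurable

lemma set_integral_sin_divide:
  assumes "0 \<le> \<epsilon>" "\<epsilon> \<le> R"
  shows "(LINT k:{\<epsilon><..<R}|lborel. sin (k * x) / k) = sgn x * (Si (R * \<bar>x\<bar>) - Si (\<epsilon> * \<bar>x\<bar>))"
proof -
  have "(LBINT k=ereal 0..ereal \<epsilon>. sin (k * x) / k) + (LBINT k=ereal \<epsilon>..ereal R. sin (k * x) / k)
      = (LBINT k=ereal 0..ereal R. sin (k * x) / k)"
    by (rule interval_integral_sum) (use assms integrable_sinc'[of R x] in \<open>simp add: min_def max_def\<close>)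
  moreover have "(LBINT k=ereal \<epsilon>..ereal R. sin (k * x) / k) = (LINT k:{\<epsilon><..<R}|lborel. sin (k * x) / k)"
    using assms by (simp add: interval_lebesgue_integral_def)
  ultimately show ?thesis
    using LBINT_I0c_sin_scale_divide[of \<epsilon> x] LBINT_I0c_sin_scale_divide[of R x] assms
    by (simp add: zero_ereal_def algebra_simps)
qed

text \<open>The truncated reciprocal is odd, so folding the two half-lines replaces the exponential
  by -2i sin.\<close>

lemma fourier_cutoff_inverse:
  assumes e: "0 < \<epsilon>" "\<epsilon> \<le> R"
  shows "fourier (cutoff_inverse \<epsilon> R) x = - 2 * \<i> * complex_of_real (sgn x * (Si (R * \<bar>x\<bar>) - Si (\<epsilon> * \<bar>x\<bar>)))"
proof -
  let ?h = "\<lambda>k. cutoff_inverse \<epsilon> R k * exp (- \<i> * complex_of_real (x * k))"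
  have int: "integrable lborel ?h" using fourier_eq_lborel(2)[OF cutoff_inverse_integrable[OF e(1)]] .
  have int': "integrable lborel (\<lambda>k. ?h (- k))"
    using lborel_integrable_real_affine[OF int, of "-1" 0] by simp
  have pos: "set_integrable lborel {0<..} ?h" and neg: "set_integrable lborel {0<..} (\<lambda>k. ?h (- k))"
    unfolding set_integrable_def using int int' by (auto intro: integrable_mult_indicator)
  have "fourier (cutoff_inverse \<epsilon> R) x = (LINT k:{0<..}|lborel. ?h k) + (LINT k:{0<..}|lborel. ?h (- k))"
    unfolding fourier_eq_lborel(1)[OF cutoff_inverse_integrable[OF e(1)]]
    by (rule integral_split_at_0(2)[OF _ pos neg]) measurable
  also have "\<dots> = (LINT k:{0<..}|lborel. ?h k + ?h (- k))"
    using set_integral_add(2)[OF pos neg] by simp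
  also have "\<dots> = (LINT k:{\<epsilon><..<R}|lborel. (- 2 * \<i>) * complex_of_real (sin (k * x) / k))"
    unfolding set_lebesgue_integral_def
  proof (rule Bochner_Integration.integral_cong[OF refl])
    fix k :: real
    have "exp (- \<i> * complex_of_real t) - exp (\<i> * complex_of_real t) = - 2 * \<i> * complex_of_real (sin t)" for t
      by (simp add: exp_minus_Euler exp_Euler sin_of_real)
    from this[of "x * k"] show "indicator {0<..} k *\<^sub>R (?h k + ?h (- k)) = indicator {\<epsilon><..<R} k *\<^sub>R (- 2 * \<i> * complex_of_real (sin (k * x) / k))"
      using e by (auto simp: cutoff_inverse_def indicator_def field_simps)
  qed
  also have "\<dots> = - 2 * \<i> * complex_of_real (LINT k:{\<epsilon><..<R}|lborel. sin (k * x) / k)"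
    by (simp only: set_integral_mult_right set_integral_complex_of_real)
  finally show ?thesis using e by (simp add: set_integral_sin_divide)
qed

lemma abs_sgn_mult_le: "\<bar>sgn x * y\<bar> \<le> \<bar>y\<bar>" for x y :: real
  by (simp add: sgn_if)

text \<open>The outer cutoff R tends to infinity in the multiplication formula, with Si(R|x|) ->
  pi/2 for x nonzero. Domination comes from 1/|k| <= 1/\<epsilon> on the frequency side and from the
  boundedness of Si on the other. The pair (1, -1) with exponent -1 is the function 1/k.\<close>

lemma two_sided_inverse_fourier:
  assumes f: "schwartz f" and e: "\<epsilon> > 0"
  shows "two_sided 1 (-1) (-1) (fourier f) \<epsilon>
    = (LINT x|lborel. - 2 * \<i> * complex_of_real (sgn x * (pi / 2 - Si (\<epsilon> * \<bar>x\<bar>))) * f x)"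
proof -
  note [measurable] = schwartz_borel_measurable[OF f] schwartz_borel_measurable[OF schwartz_fourier[OF f]]
  obtain B where B: "\<And>T. \<bar>Si T\<bar> \<le> B" using bounded_Si by blast
  let ?m = "\<lambda>R x. - 2 * \<i> * complex_of_real (sgn x * (Si (R * \<bar>x\<bar>) - Si (\<epsilon> * \<bar>x\<bar>))) * f x"
  let ?m' = "\<lambda>x. - 2 * \<i> * complex_of_real (sgn x * (pi / 2 - Si (\<epsilon> * \<bar>x\<bar>))) * f x"
  let ?d = "\<lambda>k. indicator {k. \<epsilon> < \<bar>k\<bar>} k *\<^sub>R (complex_of_real (1 / k) * fourier f k)"
  have lim1: "((\<lambda>R. LINT k|lborel. cutoff_inverse \<epsilon> R k * fourier f k) \<longlongrightarrow> (LINT k|lborel. ?d k)) at_top"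
  proof (rule integral_dominated_convergence_at_top)
    show "integrable lborel (\<lambda>k. (1 / \<epsilon>) * norm (fourier f k))"
      using schwartz_integrable[OF schwartz_fourier[OF f]] by (intro integrable_mult_right integrable_norm)
    show "AE k in lborel. ((\<lambda>R. cutoff_inverse \<epsilon> R k * fourier f k) \<longlongrightarrow> ?d k) at_top"
    proof (rule AE_I2, rule tendsto_eventually)
      fix k :: real
      show "eventually (\<lambda>R. cutoff_inverse \<epsilon> R k * fourier f k = ?d k) at_top"
        using eventually_gt_at_top[of "\<bar>k\<bar>"] by eventually_elim (auto simp: cutoff_inverse_def indicator_def)
    qed
    show "eventually (\<lambda>R. AE k in lborel. norm (cutoff_inverse \<epsilon> R k * fourier f k) \<le> (1 / \<epsilon>) * norm (fourier f k)) at_top"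
      using e by (intro always_eventually allI AE_I2)
        (auto simp: cutoff_inverse_def indicator_def norm_mult norm_divide field_simps intro!: mult_right_mono)
    show "?d \<in> borel_measurable lborel" by measurable
    show "(\<lambda>k. cutoff_inverse \<epsilon> R k * fourier f k) \<in> borel_measurable lborel" for R by measurable
  qed
  have ev: "eventually (\<lambda>R. (LINT k|lborel. cutoff_inverse \<epsilon> R k * fourier f k) = (LINT x|lborel. ?m R x)) at_top"
    using eventually_ge_at_top[of \<epsilon>]
  proof eventually_elim
    case (elim R)
    have "(LINT k|lborel. cutoff_inverse \<epsilon> R k * fourier f k) = (LINT x|lborel. fourier (cutoff_inverse \<epsilon> R) x * f x)"
      using e f by (intro fourier_multiplication_formula cutoff_inverse_integrable schwartz_integrable)
    then show ?case using fourier_cutoff_inverse[OF e elim] by simp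
  qed
  have lim2: "((\<lambda>R. LINT x|lborel. ?m R x) \<longlongrightarrow> (LINT x|lborel. ?m' x)) at_top"
  proof (rule integral_dominated_convergence_at_top)
    show "integrable lborel (\<lambda>x. 2 * (B + B) * norm (f x))"
      using schwartz_integrable[OF f] by (intro integrable_mult_right integrable_norm)
    show "AE x in lborel. ((\<lambda>R. ?m R x) \<longlongrightarrow> ?m' x) at_top"
    proof (rule AE_I2)
      fix x :: real
      show "((\<lambda>R. ?m R x) \<longlongrightarrow> ?m' x) at_top"
      proof (cases "x = 0")
        case False
        then have "filterlim (\<lambda>R. R * \<bar>x\<bar>) at_top at_top"
          by (intro filterlim_at_top_mult_tendsto_pos[OF tendsto_const _ filterlim_ident]) auto
        from filterlim_compose[OF Si_at_top this] show ?thesis by (intro tendsto_intros)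
      qed simp
    qed
    show "eventually (\<lambda>R. AE x in lborel. norm (?m R x) \<le> 2 * (B + B) * norm (f x)) at_top"
    proof (intro always_eventually allI AE_I2)
      fix R x :: real
      have "\<bar>sgn x * (Si (R * \<bar>x\<bar>) - Si (\<epsilon> * \<bar>x\<bar>))\<bar> \<le> B + B"
        using B[of "R * \<bar>x\<bar>"] B[of "\<epsilon> * \<bar>x\<bar>"] abs_sgn_mult_le[of x "Si (R * \<bar>x\<bar>) - Si (\<epsilon> * \<bar>x\<bar>)"]
        by linarith
      then have "2 * \<bar>sgn x * (Si (R * \<bar>x\<bar>) - Si (\<epsilon> * \<bar>x\<bar>))\<bar> * norm (f x) \<le> 2 * (B + B) * norm (f x)"
        by (intro mult_right_mono mult_left_mono) auto
      then show "norm (?m R x) \<le> 2 * (B + B) * norm (f x)" by (simp only: norm_mult norm_of_real) simp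
    qed
    show "?m' \<in> borel_measurable lborel" by measurable
    show "?m R \<in> borel_measurable lborel" for R by measurable
  qed
  have "(LINT k|lborel. ?d k) = (LINT x|lborel. ?m' x)"
    by (rule tendsto_unique[OF trivial_limit_at_top_linorder Lim_transform_eventually[OF lim1 ev] lim2])
  moreover have "(LINT k|lborel. ?d k) = two_sided 1 (-1) (-1) (fourier f) \<epsilon>"
  proof -
    have p: "complex_of_real (x powr (- 1)) * g = complex_of_real (1 / x) * g" if "x \<in> {\<epsilon><..}" for x g
      using that e by (simp add: powr_minus divide_inverse)
    have 1: "set_integrable lborel {\<epsilon><..} (\<lambda>k. complex_of_real (1 / k) * fourier f k)"
      using half_integrable[OF schwartz_fourier[OF f], of \<epsilon> "-1"] e
      by (subst set_integrable_cong[OF refl refl p[symmetric]]) auto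
    have 2: "set_integrable lborel {\<epsilon><..} (\<lambda>k. complex_of_real (1 / k) * fourier f (- k))"
      using half_integrable[OF schwartz_reflect[OF schwartz_fourier[OF f]], of \<epsilon> "-1"] e
      by (subst set_integrable_cong[OF refl refl p[symmetric]]) auto
    have 2: "set_integrable lborel {\<epsilon><..} (\<lambda>k. complex_of_real (1 / - k) * fourier f (- k))"
      using set_integrable_mult_right[of "-1", OF 2] by simp
    have "(LINT k|lborel. ?d k) = (LINT k:{\<epsilon><..}|lborel. complex_of_real (1 / k) * fourier f k)
       + (LINT k:{\<epsilon><..}|lborel. complex_of_real (1 / - k) * fourier f (- k))"
      using set_integral_abs_greater_split(2)[OF _ 1 2] e by (simp add: set_lebesgue_integral_def)
    also have "(LINT k:{\<epsilon><..}|lborel. complex_of_real (1 / k) * fourier f k) = half_int (-1) (fourier f) \<epsilon>"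
      unfolding half_int_def by (rule set_lebesgue_integral_cong) (simp, intro allI impI, rule p[symmetric])
    also have "(LINT k:{\<epsilon><..}|lborel. complex_of_real (1 / - k) * fourier f (- k))
       = (LINT k:{\<epsilon><..}|lborel. (-1) * (complex_of_real (k powr (-1)) * fourier f (- k)))"
      by (rule set_lebesgue_integral_cong) (simp, intro allI impI, subst p, simp_all)
    also have "\<dots> = - half_int (-1) (\<lambda>k. fourier f (- k)) \<epsilon>"
      by (simp only: set_integral_mult_right half_int_def) simp
    finally show ?thesis by (simp add: two_sided_def)
  qed
  ultimately show ?thesis by simp
qed

text \<open>As Si(\<epsilon>|x|) -> Si(0) = 0, the kernel becomes -i pi sgn x. The limit exists
  without subtracting anything: the finite part of 1/k is the Cauchy principal value.\<close>

lemma two_sided_inverse_fourier_tendsto: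
  assumes f: "schwartz f"
  shows "(two_sided 1 (-1) (-1) (fourier f) \<longlongrightarrow> two_sided (- \<i> * complex_of_real pi) (\<i> * complex_of_real pi) 0 f 0) (at_right 0)"
proof -
  note [measurable] = schwartz_borel_measurable[OF f]
  obtain B where B: "\<And>T. \<bar>Si T\<bar> \<le> B" using bounded_Si by blast
  let ?m = "\<lambda>\<epsilon> x. - 2 * \<i> * complex_of_real (sgn x * (pi / 2 - Si (\<epsilon> * \<bar>x\<bar>))) * f x"
  have Si0: "Si 0 = 0" by (simp add: Si_def zero_ereal_def)
  have "((\<lambda>\<epsilon>. LINT x|lborel. ?m \<epsilon> x) \<longlongrightarrow> (LINT x|lborel. ?m 0 x)) (at_right 0)"
  proof (rule integral_dominated_convergence_at_right)
    show "integrable lborel (\<lambda>x. 2 * (pi / 2 + B) * norm (f x))"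
      using schwartz_integrable[OF f] by (intro integrable_mult_right integrable_norm)
    show "AE x in lborel. ((\<lambda>\<epsilon>. ?m \<epsilon> x) \<longlongrightarrow> ?m 0 x) (at_right 0)"
      by (intro AE_I2 tendsto_intros isCont_tendsto_compose[OF isCont_Si])
    show "eventually (\<lambda>\<epsilon>. AE x in lborel. norm (?m \<epsilon> x) \<le> 2 * (pi / 2 + B) * norm (f x)) (at_right 0)"
    proof (intro always_eventually allI AE_I2)
      fix \<epsilon> x :: real
      have "B \<ge> 0" using B[of 0] by simp
      then have "\<bar>sgn x * (pi / 2 - Si (\<epsilon> * \<bar>x\<bar>))\<bar> \<le> pi / 2 + B"
        using B[of "\<epsilon> * \<bar>x\<bar>"] pi_gt_zero abs_sgn_mult_le[of x "pi / 2 - Si (\<epsilon> * \<bar>x\<bar>)"] by linarith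
      then have "2 * \<bar>sgn x * (pi / 2 - Si (\<epsilon> * \<bar>x\<bar>))\<bar> * norm (f x) \<le> 2 * (pi / 2 + B) * norm (f x)"
        by (intro mult_right_mono mult_left_mono) auto
      then show "norm (?m \<epsilon> x) \<le> 2 * (pi / 2 + B) * norm (f x)" by (simp only: norm_mult norm_of_real) simp
    qed
    show "?m 0 \<in> borel_measurable lborel" by measurable
    show "?m \<epsilon> \<in> borel_measurable lborel" for \<epsilon> by measurable
  qed
  moreover have "(LINT x|lborel. ?m 0 x) = two_sided (- \<i> * complex_of_real pi) (\<i> * complex_of_real pi) 0 f 0"
  proof -
    have pos: "?m 0 x = (- \<i> * complex_of_real pi) * (complex_of_real (x powr 0) * f x)"
      and neg: "?m 0 (- x) = (\<i> * complex_of_real pi) * (complex_of_real (x powr 0) * f (- x))"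
      if "x \<in> {0<..}" for x
      using that by (simp_all add: Si0)
    have "set_integrable lborel {0<..} (\<lambda>x. (- \<i> * complex_of_real pi) * (complex_of_real (x powr 0) * f x))"
      by (intro set_integrable_mult_right half_integrable_0 f) simp
    then have 1: "set_integrable lborel {0<..} (?m 0)"
      by (rule iffD2[OF set_integrable_cong[OF refl refl], rotated]) (rule pos)
    have "set_integrable lborel {0<..} (\<lambda>x. (\<i> * complex_of_real pi) * (complex_of_real (x powr 0) * f (- x)))"
      by (intro set_integrable_mult_right half_integrable_0 schwartz_reflect f) simp
    then have 2: "set_integrable lborel {0<..} (\<lambda>x. ?m 0 (- x))"
      by (rule iffD2[OF set_integrable_cong[OF refl refl], rotated]) (rule neg)
    have "(LINT x|lborel. ?m 0 x) = (LINT x:{0<..}|lborel. ?m 0 x) + (LINT x:{0<..}|lborel. ?m 0 (- x))"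
      by (rule integral_split_at_0(2)[OF _ 1 2]) measurable
    also have "(LINT x:{0<..}|lborel. ?m 0 x) = (LINT x:{0<..}|lborel. (- \<i> * complex_of_real pi) * (complex_of_real (x powr 0) * f x))"
      by (rule set_lebesgue_integral_cong) (simp, intro allI impI, rule pos)
    also have "(LINT x:{0<..}|lborel. ?m 0 (- x)) = (LINT x:{0<..}|lborel. (\<i> * complex_of_real pi) * (complex_of_real (x powr 0) * f (- x)))"
      by (rule set_lebesgue_integral_cong) (simp, intro allI impI, rule neg)
    finally show ?thesis
      by (simp only: set_integral_mult_right half_int_def two_sided_def)
  qed
  ultimately have "((\<lambda>\<epsilon>. LINT x|lborel. ?m \<epsilon> x) \<longlongrightarrow> two_sided (- \<i> * complex_of_real pi) (\<i> * complex_of_real pi) 0 f 0) (at_right 0)"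
    by simp
  then show ?thesis
  proof (rule Lim_transform_eventually)
    show "eventually (\<lambda>\<epsilon>. (LINT x|lborel. ?m \<epsilon> x) = two_sided 1 (-1) (-1) (fourier f) \<epsilon>) (at_right 0)"
      using eventually_at_right_less[of 0] by eventually_elim (simp add: two_sided_inverse_fourier[OF f])
  qed
qed

section \<open>Shifting the exponent\<close>

lemma has_finite_part_two_sided_scale:
  assumes "has_finite_part (two_sided A B a f) c" "A' = z * A" "B' = z * B" "a' = a" "c' = z * c"
  shows "has_finite_part (two_sided A' B' a' f) c'"
proof -
  have "two_sided A' B' a' f = (\<lambda>\<epsilon>. z * two_sided A B a f \<epsilon>)"
    using assms by (auto simp: two_sided_def algebra_simps)
  then show ?thesis using has_finite_part_cmult[OF assms(1)] assms(5) by simp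
qed

lemma has_finite_part_two_sided_combine:
  assumes "has_finite_part (two_sided 1 0 a f) c" "has_finite_part (two_sided 0 1 a f) d"
  shows "has_finite_part (two_sided A B a f) (A * c + B * d)"
proof -
  have "two_sided A B a f = (\<lambda>\<epsilon>. A * two_sided 1 0 a f \<epsilon> + B * two_sided 0 1 a f \<epsilon>)"
    by (auto simp: two_sided_def)
  then show ?thesis
    using has_finite_part_add[OF has_finite_part_cmult[OF assms(1)] has_finite_part_cmult[OF assms(2)]] by simp
qed

text \<open>Since F(f') = ik F f, a derivative on the test function is traded for a factor k, which
  is absorbed into the power.\<close>

lemma has_finite_part_fourier_raise:
  assumes f: "schwartz f" and c: "has_finite_part (two_sided A B a (fourier (vderiv f))) c"
  shows "has_finite_part (two_sided A (- B) (a + 1) (fourier f)) (- \<i> * c)"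
proof -
  have "(\<lambda>x. - \<i> * fourier (vderiv f) x) = (\<lambda>x. complex_of_real x * fourier f x)"
    by (auto simp: fourier_vderiv[OF f] mult.assoc[symmetric])
  with has_finite_part_two_sided_cmult[OF c, of "- \<i>"] show ?thesis
    by (simp add: has_finite_part_two_sided_times_x)
qed

text \<open>Here (F f)' = F(-ixf): a factor x on the test function becomes a derivative, which
  integration by parts moves onto the power.\<close>

lemma has_finite_part_fourier_lower:
  assumes f: "schwartz f" and "b \<noteq> 0" "\<And>n::nat. b = - real n \<Longrightarrow> A + B * (-1) ^ n = 0"
    and c: "has_finite_part (two_sided A (- B) b (fourier (\<lambda>x. - \<i> * (complex_of_real x * f x)))) c"
  shows "has_finite_part (two_sided A B (b - 1) (fourier f)) (- c / complex_of_real b)"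
  by (rule has_finite_part_two_sided_vderiv[OF schwartz_fourier[OF f] assms(2,3)])
    (use c in \<open>simp_all add: vderiv_fourier[OF f]\<close>)

lemma has_finite_part_two_sided_i_times_x:
  assumes "has_finite_part (two_sided A B a (\<lambda>x. - \<i> * (complex_of_real x * f x))) c"
  shows "has_finite_part (two_sided A (- B) (a + 1) f) (\<i> * c)"
  using has_finite_part_two_sided_cmult[OF assms, of \<i>]
  by (simp add: has_finite_part_two_sided_times_x mult.assoc[symmetric])

section \<open>Non-integer exponents\<close>

text \<open>The coefficient of x_+^(-a-1) in the transform of A x_+^a + B x_-^a. Reflection
  exchanges the half-lines, so the coefficient of x_-^(-a-1) is obtained by swapping
  \<open>A\<close> and \<open>B\<close>.\<close>

definition fourier_coeff :: "real \<Rightarrow> complex \<Rightarrow> complex \<Rightarrow> complex" where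
  "fourier_coeff a A B = complex_of_real (Gamma (a + 1)) *
     (A * cis (- (pi / 2 * (a + 1))) + B * cis (pi / 2 * (a + 1)))"

text \<open>The Gamma recursion supplies a + 1; advancing the angle by pi/2 multiplies the two
  phases by -i and i, whose opposite signs turn \<open>B\<close> into \<open>- B\<close>.\<close>

lemma fourier_coeff_plus_1:
  assumes "a \<notin> \<int>"
  shows "fourier_coeff (a + 1) A B = - \<i> * complex_of_real (a + 1) * fourier_coeff a A (- B)"
proof -
  have "a + 1 \<notin> \<int>" using assms Ints_diff[of "a + 1" 1] by auto
  then have "a + 1 \<notin> \<int>\<^sub>\<le>\<^sub>0" using nonpos_Ints_Int by auto
  then have G: "Gamma (a + 1 + 1) = (a + 1) * Gamma (a + 1)" by (rule Gamma_plus1)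
  have "pi / 2 * (a + 1 + 1) = pi / 2 + pi / 2 * (a + 1)" by (simp add: algebra_simps)
  moreover have "cis (pi / 2 + t) = \<i> * cis t" "cis (- (pi / 2 + t)) = - \<i> * cis (- t)" for t
    using cis_mult[of "pi / 2" t] cis_mult[of "- (pi / 2)" "- t"] by (simp_all add: cis_minus_pi_half)
  ultimately show ?thesis
    unfolding fourier_coeff_def G by (simp only:) (simp add: algebra_simps)
qed

lemma fourier_coeff_uminus: "fourier_coeff a (- A) (- B) = - fourier_coeff a A B"
  by (simp add: fourier_coeff_def algebra_simps)

text \<open>All \<open>f\<close>, \<open>A\<close> and \<open>B\<close> are quantified because each
  shift alters the test function and negates \<open>B\<close>. The shared \<open>c\<close> asserts
  existence of both finite parts along with their equality.\<close>

definition fourier_power_rule :: "real \<Rightarrow> bool" where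
  "fourier_power_rule a \<longleftrightarrow> (\<forall>f A B. schwartz f \<longrightarrow> (\<exists>c. has_finite_part (two_sided A B a (fourier f)) c \<and>
     has_finite_part (two_sided (fourier_coeff a A B) (fourier_coeff a B A) (- a - 1) f) c))"

lemma fourier_power_ruleE:
  assumes "fourier_power_rule a" "schwartz f"
  obtains c where "has_finite_part (two_sided A B a (fourier f)) c"
    "has_finite_part (two_sided (fourier_coeff a A B) (fourier_coeff a B A) (- a - 1) f) c"
  using assms unfolding fourier_power_rule_def by blast

lemma fourier_power_rule_base:
  assumes "-1 < a" "a < 0"
  shows "fourier_power_rule a"
  unfolding fourier_power_rule_def
proof (intro allI impI exI conjI)
  fix f A B assume f: "schwartz f"
  have "(two_sided A B a (fourier f) \<longlongrightarrow> two_sided A B a (fourier f) 0) (at_right 0)"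
    using assms by (intro two_sided_tendsto schwartz_fourier f)
  then show "has_finite_part (two_sided A B a (fourier f)) (two_sided A B a (fourier f) 0)"
    by (rule has_finite_part_tendsto)
  have "two_sided A B a (fourier f) 0 = two_sided (fourier_coeff a A B) (fourier_coeff a B A) (- a - 1) f 0"
    using half_int_fourier[OF f assms] half_int_fourier[OF schwartz_reflect[OF f] assms]
    unfolding fourier_reflect[OF f, abs_def]
    by (simp add: two_sided_def fourier_coeff_def algebra_simps)
  moreover have "(two_sided (fourier_coeff a A B) (fourier_coeff a B A) (- a - 1) f
      \<longlongrightarrow> two_sided (fourier_coeff a A B) (fourier_coeff a B A) (- a - 1) f 0) (at_right 0)"
    using assms by (intro two_sided_tendsto f) auto
  ultimately show "has_finite_part (two_sided (fourier_coeff a A B) (fourier_coeff a B A) (- a - 1) f) (two_sided A B a (fourier f) 0)"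
    by (simp add: has_finite_part_tendsto)
qed

lemma not_Ints_neq_of_nat:
  assumes "a \<notin> \<int>"
  shows "a + 1 \<noteq> 0" "a + 1 \<noteq> - real n" "- a - 1 \<noteq> - real n"
proof -
  have "a \<noteq> of_int k" for k using assms by auto
  from this[of "-1"] this[of "- int n - 1"] this[of "int n - 1"]
  show "a + 1 \<noteq> 0" "a + 1 \<noteq> - real n" "- a - 1 \<noteq> - real n" by auto
qed

text \<open>The rule for \<open>a\<close> is applied to f'. The derivative becomes a factor k on the
  transformed side and is integrated by parts on the other; \<open>- a - 1\<close> is not an
  integer, so no constant boundary term arises.\<close>

lemma fourier_power_rule_raise:
  assumes a: "a \<notin> \<int>" and rule: "fourier_power_rule a"
  shows "fourier_power_rule (a + 1)"
  unfolding fourier_power_rule_def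
proof (intro allI impI)
  fix f A B assume f: "schwartz f"
  obtain c where c: "has_finite_part (two_sided A (- B) a (fourier (vderiv f))) c"
    "has_finite_part (two_sided (fourier_coeff a A (- B)) (fourier_coeff a (- B) A) (- a - 1) (vderiv f)) c"
    using rule schwartz_vderiv[OF f] by (rule fourier_power_ruleE)
  have "has_finite_part (two_sided (fourier_coeff a A (- B)) (- fourier_coeff a (- B) A) (- a - 1 - 1) f)
      (- c / complex_of_real (- a - 1))"
    using c(2) not_Ints_neq_of_nat[OF a] by (intro has_finite_part_two_sided_vderiv[OF f]) auto
  then have "has_finite_part (two_sided (fourier_coeff (a + 1) A B) (fourier_coeff (a + 1) B A) (- (a + 1) - 1) f) (- \<i> * c)"
  proof (rule has_finite_part_two_sided_scale[where z = "- \<i> * complex_of_real (a + 1)"])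
    show "fourier_coeff (a + 1) A B = - \<i> * complex_of_real (a + 1) * fourier_coeff a A (- B)"
      by (rule fourier_coeff_plus_1[OF a])
    show "fourier_coeff (a + 1) B A = - \<i> * complex_of_real (a + 1) * - fourier_coeff a (- B) A"
      using fourier_coeff_plus_1[OF a, of B A] fourier_coeff_uminus[of a "- B" A] by simp
    have eq: "- a - 1 = - (a + 1)" by simp
    have nz: "complex_of_real (a + 1) \<noteq> 0"
      using not_Ints_neq_of_nat(1)[OF a] by (simp only: of_real_eq_0_iff) simp
    then show "- \<i> * c = - \<i> * complex_of_real (a + 1) * (- c / complex_of_real (- a - 1))"
      unfolding eq of_real_minus by (simp del: of_real_add)
  qed simp
  then show "\<exists>c. has_finite_part (two_sided A B (a + 1) (fourier f)) c \<and>
      has_finite_part (two_sided (fourier_coeff (a + 1) A B) (fourier_coeff (a + 1) B A) (- (a + 1) - 1) f) c"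
    using has_finite_part_fourier_raise[OF f c(1)] by auto
qed

text \<open>The mirror image of raising: the rule for \<open>a + 1\<close> is applied to -ixf, and
  now the integration by parts takes place on the transformed side.\<close>

lemma fourier_power_rule_lower:
  assumes a: "a \<notin> \<int>" and rule: "fourier_power_rule (a + 1)"
  shows "fourier_power_rule a"
  unfolding fourier_power_rule_def
proof (intro allI impI)
  fix f A B assume f: "schwartz f"
  obtain c where c: "has_finite_part (two_sided A (- B) (a + 1) (fourier (\<lambda>x. - \<i> * (complex_of_real x * f x)))) c"
    "has_finite_part (two_sided (fourier_coeff (a + 1) A (- B)) (fourier_coeff (a + 1) (- B) A) (- (a + 1) - 1)
       (\<lambda>x. - \<i> * (complex_of_real x * f x))) c"
    using rule schwartz_cmult[OF schwartz_times_x[OF f]] by (rule fourier_power_ruleE)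
  have "has_finite_part (two_sided A B (a + 1 - 1) (fourier f)) (- c / complex_of_real (a + 1))"
    using c(1) not_Ints_neq_of_nat[OF a] by (intro has_finite_part_fourier_lower[OF f]) auto
  moreover have "has_finite_part (two_sided (fourier_coeff a A B) (fourier_coeff a B A) (- a - 1) f) (- c / complex_of_real (a + 1))"
  proof (rule has_finite_part_two_sided_scale[OF has_finite_part_two_sided_i_times_x[OF c(2)],
        where z = "\<i> / complex_of_real (a + 1)"])
    have nz: "complex_of_real (a + 1) \<noteq> 0"
      using not_Ints_neq_of_nat(1)[OF a] by (simp only: of_real_eq_0_iff) simp
    show "fourier_coeff a A B = \<i> / complex_of_real (a + 1) * fourier_coeff (a + 1) A (- B)"
      unfolding fourier_coeff_plus_1[OF a] using nz by (simp add: field_simps)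
    show "fourier_coeff a B A = \<i> / complex_of_real (a + 1) * - fourier_coeff (a + 1) (- B) A"
      unfolding fourier_coeff_plus_1[OF a] fourier_coeff_uminus using nz by (simp add: field_simps)
    show "- c / complex_of_real (a + 1) = \<i> / complex_of_real (a + 1) * (\<i> * c)" by simp
  qed simp
  ultimately show "\<exists>c. has_finite_part (two_sided A B a (fourier f)) c \<and>
      has_finite_part (two_sided (fourier_coeff a A B) (fourier_coeff a B A) (- a - 1) f) c"
    by auto
qed

lemma fourier_power_rule_not_Ints:
  assumes a: "a \<notin> \<int>"
  shows "fourier_power_rule a"
proof -
  \<comment> \<open>The representative of \<open>a\<close> modulo 1 in (-1, 0), from which integer
    induction in both directions reaches \<open>a\<close>.\<close>
  define t where "t = a - of_int (\<lfloor>a\<rfloor> + 1)"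
  have "a \<noteq> of_int \<lfloor>a\<rfloor>" using a by (metis Ints_of_int)
  then have t: "-1 < t" "t < 0" unfolding t_def by linarith+
  have nonint: "t + of_int k \<notin> \<int>" for k
  proof
    assume "t + of_int k \<in> \<int>"
    then have "t + of_int k + of_int (\<lfloor>a\<rfloor> + 1 - k) \<in> \<int>" by (rule Ints_add[OF _ Ints_of_int])
    moreover have "t + of_int k + of_int (\<lfloor>a\<rfloor> + 1 - k) = a" by (simp add: t_def)
    ultimately show False using a by (simp only:)
  qed
  have "fourier_power_rule (t + of_int k)" for k
  proof (induction k rule: int_induct[of _ 0])
    case base
    then show ?case using fourier_power_rule_base[OF t] by simp
  next
    case (step1 i)
    then show ?case using fourier_power_rule_raise[OF nonint] by (simp add: add.assoc)
  next
    case (step2 i)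
    then show ?case using fourier_power_rule_lower[OF nonint, of "i - 1"] by simp
  qed
  from this[of "\<lfloor>a\<rfloor> + 1"] show ?thesis by (simp add: t_def)
qed

section \<open>Integer exponents\<close>

text \<open>The pair (1, (-1)^(j+1)) is the true power x^(-j-1), and the right-hand side is
  \<gamma>_j x^j sgn x. Starting from -i pi sgn x, each lowering step multiplies \<gamma> by
  -i/(j+1), which accounts for the power of -i and the factorial.\<close>

lemma fourier_negative_integer_power:
  fixes j :: nat
  assumes "schwartz f"
  defines "\<gamma> \<equiv> \<lambda>j. complex_of_real pi * (- \<i>) ^ Suc j / fact j"
  shows "\<exists>c. has_finite_part (two_sided 1 ((-1) ^ Suc j) (- real (Suc j)) (fourier f)) c \<and>
    has_finite_part (two_sided (\<gamma> j) ((-1) ^ Suc j * \<gamma> j) (real j) f) c"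
  using assms(1)
proof (induction j arbitrary: f)
  case 0
  have "(two_sided (- \<i> * complex_of_real pi) (\<i> * complex_of_real pi) 0 f
      \<longlongrightarrow> two_sided (- \<i> * complex_of_real pi) (\<i> * complex_of_real pi) 0 f 0) (at_right 0)"
    using 0 by (intro two_sided_tendsto) auto
  with two_sided_inverse_fourier_tendsto[OF 0] show ?case
    by (auto intro!: exI has_finite_part_tendsto simp: \<gamma>_def mult.commute)
next
  case (Suc j)
  let ?g = "\<lambda>x. - \<i> * (complex_of_real x * f x)"
  obtain c where c: "has_finite_part (two_sided 1 ((-1) ^ Suc j) (- real (Suc j)) (fourier ?g)) c"
    "has_finite_part (two_sided (\<gamma> j) ((-1) ^ Suc j * \<gamma> j) (real j) ?g) c"
    using Suc.IH[OF schwartz_cmult[OF schwartz_times_x[OF Suc.prems]]] by blast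
  have lhs: "has_finite_part (two_sided 1 ((-1) ^ Suc (Suc j)) (- real (Suc j) - 1) (fourier f)) (- c / complex_of_real (- real (Suc j)))"
  proof (rule has_finite_part_fourier_lower[OF Suc.prems])
    \<comment> \<open>The exponent \<open>b = - real (Suc j)\<close> is one at which a boundary
      constant could survive; the signs of an exact integer power cancel it.\<close>
    fix n :: nat assume "- real (Suc j) = - real n"
    then have n: "n = Suc j" by linarith
    show "1 + (- 1) ^ Suc (Suc j) * (- 1) ^ n = (0::complex)"
      unfolding n by (simp add: power_mult_distrib[symmetric])
  qed (use c in auto)
  have rhs: "has_finite_part (two_sided (\<gamma> (Suc j)) ((-1) ^ Suc (Suc j) * \<gamma> (Suc j)) (real (Suc j)) f)
      (- c / complex_of_real (- real (Suc j)))"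
  proof (rule has_finite_part_two_sided_scale[OF has_finite_part_two_sided_i_times_x[OF c(2)],
        where z = "- \<i> / of_nat (Suc j)"])
    show g: "\<gamma> (Suc j) = - \<i> / of_nat (Suc j) * \<gamma> j"
      unfolding \<gamma>_def power_Suc[of _ "Suc j"] fact_Suc by (simp del: of_nat_Suc power_Suc)
    show "(- 1) ^ Suc (Suc j) * \<gamma> (Suc j) = - \<i> / of_nat (Suc j) * - ((- 1) ^ Suc j * \<gamma> j)"
      unfolding g by simp
    show "- c / complex_of_real (- real (Suc j)) = - \<i> / of_nat (Suc j) * (\<i> * c)"
      by (simp del: of_nat_Suc)
  qed simp
  have eq: "- real (Suc j) - 1 = - real (Suc (Suc j))" by simp
  show ?case by (rule exI, rule conjI[OF lhs[unfolded eq] rhs])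
qed

text \<open>For n = 0, raising the exponent -1 rule at f' gives -i times the pairing of -i pi sgn
  with f', that is 2 pi f(0). Each further step replaces f by f' and contributes -i.\<close>

lemma fourier_nonnegative_integer_power:
  assumes "schwartz f"
  shows "has_finite_part (two_sided 1 ((-1) ^ n) (real n) (fourier f))
     (2 * complex_of_real pi * (- \<i>) ^ n * (vderiv ^^ n) f 0)"
  using assms
proof (induction n arbitrary: f)
  case (0 f)
  let ?p = "\<i> * complex_of_real pi"
  let ?c = "two_sided (- ?p) ?p 0 (vderiv f) 0"
  have "has_finite_part (two_sided 1 (- (- 1)) (- 1 + 1) (fourier f)) (- \<i> * ?c)"
    using two_sided_inverse_fourier_tendsto[OF schwartz_vderiv[OF 0]]
    by (intro has_finite_part_fourier_raise[OF 0] has_finite_part_tendsto) simp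
  moreover have "?c = 2 * ?p * f 0"
  proof (rule tendsto_unique[OF trivial_limit_at_right_real])
    show "(two_sided (- ?p) ?p 0 (vderiv f) \<longlongrightarrow> ?c) (at_right 0)"
      using schwartz_vderiv[OF 0] by (intro two_sided_tendsto) auto
    have "isCont (\<lambda>\<epsilon>. ?p * (f \<epsilon> + f (- \<epsilon>))) 0"
      using 0 schwartz_reflect[OF 0] by (intro continuous_intros schwartz_isCont)
    then have "((\<lambda>\<epsilon>. ?p * (f \<epsilon> + f (- \<epsilon>))) \<longlongrightarrow> ?p * (f 0 + f (- 0))) (at_right 0)"
      unfolding isCont_def filterlim_at_split by blast
    then have "((\<lambda>\<epsilon>. ?p * (f \<epsilon> + f (- \<epsilon>))) \<longlongrightarrow> 2 * ?p * f 0) (at_right 0)"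
      by (rule back_subst[where P = "\<lambda>z. (_ \<longlongrightarrow> z) _"]) simp
    \<comment> \<open>At exponent 0 integration by parts leaves only the boundary term, so sgn
      paired with f' reduces to the values of f at the two cutoff points.\<close>
    moreover have "eventually (\<lambda>\<epsilon>. ?p * (f \<epsilon> + f (- \<epsilon>)) = two_sided (- ?p) ?p 0 (vderiv f) \<epsilon>) (at_right 0)"
      using eventually_at_right_less[of 0]
    proof eventually_elim
      case (elim \<epsilon>)
      then show ?case using two_sided_vderiv[OF 0 elim, of "- ?p" "- ?p" 0] by (simp add: algebra_simps)
    qed
    ultimately show "(two_sided (- ?p) ?p 0 (vderiv f) \<longlongrightarrow> 2 * ?p * f 0) (at_right 0)"
      by (rule Lim_transform_eventually)
  qed
  ultimately show ?case by (simp add: mult_ac)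
next
  case (Suc n f)
  from has_finite_part_fourier_raise[OF Suc.prems Suc.IH[OF schwartz_vderiv[OF Suc.prems]]]
  show ?case by (simp add: funpow_swap1 mult_ac add.commute)
qed

section \<open>Complex powers on the two axes, and evaluation of the distributions\<close>

text \<open>The chosen branch gives negative reals the argument -pi, opposite to the convention of
  \<open>Ln\<close>; this is the origin of the factor e^(-i pi \<alpha>).\<close>

lemma pcpow_of_real:
  assumes "x > 0"
  shows "pcpow (complex_of_real x) (complex_of_real a) = complex_of_real (x powr a)"
    and "pcpow (complex_of_real (- x)) (complex_of_real a) = cis (- (pi * a)) * complex_of_real (x powr a)"
proof -
  have p: "complex_of_real (x powr a) = exp (complex_of_real (a * ln x))"
    using assms by (simp only: powr_def exp_of_real) simp
  show "pcpow (complex_of_real x) (complex_of_real a) = complex_of_real (x powr a)"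
    unfolding p using assms by (simp add: pcpow_def plog_def Ln_of_real)
  show "pcpow (complex_of_real (- x)) (complex_of_real a) = cis (- (pi * a)) * complex_of_real (x powr a)"
    unfolding p cis_conv_exp exp_add[symmetric] using assms by (simp add: pcpow_def plog_def algebra_simps)
qed

lemma pcpow_i_times_of_real:
  assumes "x > 0"
  shows "pcpow (\<i> * complex_of_real x) (complex_of_real a) = cis (pi / 2 * a) * complex_of_real (x powr a)"
    and "pcpow (- (\<i> * complex_of_real x)) (complex_of_real a) = cis (- (pi / 2 * a)) * complex_of_real (x powr a)"
  using exp_Ln_imaginary[OF assms, of a] assms by (simp_all add: pcpow_def plog_def)

text \<open>The passage from gauge integrals of complex powers to folded Lebesgue integrals. The
  case \<open>\<epsilon> = 0\<close> serves the regular distribution, positive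
  \<open>\<epsilon>\<close> the finite parts.\<close>

lemma integral_homogeneous_eq_two_sided:
  assumes f: "schwartz f" and e: "\<epsilon> > 0 \<or> \<epsilon> = 0 \<and> a > -1"
    and F: "\<And>x. x > 0 \<Longrightarrow> F x = A * complex_of_real (x powr a)"
      "\<And>x. x > 0 \<Longrightarrow> F (- x) = B * complex_of_real (x powr a)"
  shows "integral {x. \<epsilon> < \<bar>x\<bar>} (\<lambda>x. F x * f x) = two_sided A B a f \<epsilon>"
proof -
  have e0: "\<epsilon> \<ge> 0" using e by auto
  have pos: "F x * f x = A * (complex_of_real (x powr a) * f x)"
    and neg: "F (- x) * f (- x) = B * (complex_of_real (x powr a) * f (- x))"
    if "x \<in> {\<epsilon><..}" for x
    using that e0 F[of x] by (simp_all add: mult.assoc)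
  have "set_integrable lborel {\<epsilon><..} (\<lambda>x. A * (complex_of_real (x powr a) * f x))"
    by (intro set_integrable_mult_right half_integrable f e)
  then have 1: "set_integrable lborel {\<epsilon><..} (\<lambda>x. F x * f x)"
    by (rule iffD2[OF set_integrable_cong[OF refl refl], rotated]) (rule pos)
  have "set_integrable lborel {\<epsilon><..} (\<lambda>x. B * (complex_of_real (x powr a) * f (- x)))"
    by (intro set_integrable_mult_right half_integrable schwartz_reflect f e)
  then have 2: "set_integrable lborel {\<epsilon><..} (\<lambda>x. F (- x) * f (- x))"
    by (rule iffD2[OF set_integrable_cong[OF refl refl], rotated]) (rule neg)
  have "integral {x. \<epsilon> < \<bar>x\<bar>} (\<lambda>x. F x * f x) = (LINT x:{x. \<epsilon> < \<bar>x\<bar>}|lborel. F x * f x)"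
    using set_borel_integral_eq_integral(2)[OF set_integral_abs_greater_split(1)[OF e0 1 2]] by simp
  also have "\<dots> = (LINT x:{\<epsilon><..}|lborel. F x * f x) + (LINT x:{\<epsilon><..}|lborel. F (- x) * f (- x))"
    by (rule set_integral_abs_greater_split(2)[OF e0 1 2])
  also have "(LINT x:{\<epsilon><..}|lborel. F x * f x) = (LINT x:{\<epsilon><..}|lborel. A * (complex_of_real (x powr a) * f x))"
    by (rule set_lebesgue_integral_cong) (simp, intro allI impI, rule pos)
  also have "(LINT x:{\<epsilon><..}|lborel. F (- x) * f (- x)) = (LINT x:{\<epsilon><..}|lborel. B * (complex_of_real (x powr a) * f (- x)))"
    by (rule set_lebesgue_integral_cong) (simp, intro allI impI, rule neg)
  finally show ?thesis
    by (simp only: set_integral_mult_right half_int_def two_sided_def)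
qed

lemma Pf_homogeneous:
  assumes f: "schwartz f" and c: "has_finite_part (two_sided A B a f) c"
    and F: "\<And>x. x > 0 \<Longrightarrow> F x = A * complex_of_real (x powr a)"
      "\<And>x. x > 0 \<Longrightarrow> F (- x) = B * complex_of_real (x powr a)"
  shows "Pf F f = c"
  unfolding Pf_def
proof (rule finite_part_eqI, rule has_finite_part_cong[OF c])
  show "eventually (\<lambda>\<epsilon>. two_sided A B a f \<epsilon> = integral {x. \<epsilon> < \<bar>x\<bar>} (\<lambda>x. F x * f x)) (at_right 0)"
    using eventually_at_right_less[of 0]
  proof eventually_elim
    case (elim \<epsilon>)
    then show ?case using integral_homogeneous_eq_two_sided[OF f _ F, of \<epsilon>] by simp
  qed
qed

lemma fourier_dist_Pf_power:
  assumes "schwartz f" "has_finite_part (two_sided 1 (cis (- (pi * a))) a (fourier f)) c"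
  shows "fourier_dist (Pf (\<lambda>x. pcpow (complex_of_real x) (complex_of_real a))) f = c"
  unfolding fourier_dist_def
  by (rule Pf_homogeneous[OF schwartz_fourier[OF assms(1)] assms(2)]) (simp_all only: pcpow_of_real mult_1)

lemma cis_pi_times_nat: "cis (pi * real n) = (-1) ^ n" "cis (- (pi * real n)) = (-1) ^ n"
  using Complex.DeMoivre[of pi n] Complex.DeMoivre[of "- pi" n]
  by (simp_all add: mult.commute cis_cnj[symmetric])

lemma inverse_cis_times: "1 / (cis t * complex_of_real y) = cis (- t) * complex_of_real (inverse y)"
  by (simp add: divide_inverse)

lemma pcpow_i: "pcpow \<i> (complex_of_real a) = cis (pi / 2 * a)"
  using pcpow_i_times_of_real(1)[of 1 a] by simp

lemma pcpow_i_nat: "pcpow \<i> (complex_of_real (real n)) = \<i> ^ n"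
    "pcpow \<i> (complex_of_real (- real n)) = (- \<i>) ^ n"
  unfolding pcpow_i using Complex.DeMoivre[of "pi / 2" n] Complex.DeMoivre[of "- (pi / 2)" n]
  by (simp_all add: mult.commute cis_minus_pi_half)

theorem theorem3p2:
  fixes \<alpha> :: real and \<phi> :: "real \<Rightarrow> complex"
  assumes "schwartz \<phi>"
  shows "(\<forall>n::nat. \<alpha> = real n \<longrightarrow>
            fourier_dist (Pf (\<lambda>x. pcpow (complex_of_real x) (complex_of_real \<alpha>))) \<phi>
              = 2 * complex_of_real pi * pcpow \<i> (complex_of_real \<alpha>) * dist_deriv n dirac \<phi>)
       \<and> (\<forall>m::nat. m \<ge> 1 \<and> \<alpha> = - real m \<longrightarrow>
            fourier_dist (Pf (\<lambda>x. pcpow (complex_of_real x) (complex_of_real \<alpha>))) \<phi>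
              = regular_dist (\<lambda>x. complex_of_real pi * pcpow \<i> (complex_of_real \<alpha>)
                    * pcpow (complex_of_real x) (complex_of_real (- \<alpha> - 1))
                    / complex_of_real (fact (m - 1)) * complex_of_real (sgn x)) \<phi>)
       \<and> (\<alpha> \<notin> \<int> \<longrightarrow>
            fourier_dist (Pf (\<lambda>x. pcpow (complex_of_real x) (complex_of_real \<alpha>))) \<phi>
              = complex_of_real (Gamma (\<alpha> + 1)) *
                 (exp (- \<i> * complex_of_real (pi * \<alpha>))
                    * Pf (\<lambda>x. 1 / pcpow (- \<i> * complex_of_real x) (complex_of_real (\<alpha> + 1))) \<phi>
                  + Pf (\<lambda>x. 1 / pcpow (\<i> * complex_of_real x) (complex_of_real (\<alpha> + 1))) \<phi>))"
proof (intro conjI allI impI)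
  note f = \<open>schwartz \<phi>\<close>
  let ?T = "Pf (\<lambda>x. pcpow (complex_of_real x) (complex_of_real \<alpha>))"
  {
    fix n :: nat
    assume n: "\<alpha> = real n"
    have "fourier_dist ?T \<phi> = 2 * complex_of_real pi * (- \<i>) ^ n * (vderiv ^^ n) \<phi> 0"
      using fourier_nonnegative_integer_power[OF f, of n]
      by (intro fourier_dist_Pf_power f) (simp add: n cis_pi_times_nat)
    \<comment> \<open>The factor (-1)^n split off here is the sign built into the distributional
      derivative.\<close>
    moreover have "(- \<i>) ^ n = (-1) ^ n * \<i> ^ n" by (rule power_minus)
    ultimately show "fourier_dist ?T \<phi> = 2 * complex_of_real pi * pcpow \<i> (complex_of_real \<alpha>) * dist_deriv n dirac \<phi>"
      unfolding n pcpow_i_nat dist_deriv_def dirac_def by simp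
  next
    fix m :: nat
    assume m: "m \<ge> 1 \<and> \<alpha> = - real m"
    then obtain j where j: "m = Suc j" by (cases m) auto
    define \<gamma> where "\<gamma> = complex_of_real pi * (- \<i>) ^ Suc j / fact j"
    let ?g = "\<lambda>x. complex_of_real pi * pcpow \<i> (complex_of_real \<alpha>)
                    * pcpow (complex_of_real x) (complex_of_real (- \<alpha> - 1))
                    / complex_of_real (fact (m - 1)) * complex_of_real (sgn x)"
    obtain c where c: "has_finite_part (two_sided 1 ((-1) ^ Suc j) (- real (Suc j)) (fourier \<phi>)) c"
      "has_finite_part (two_sided \<gamma> ((-1) ^ Suc j * \<gamma>) (real j) \<phi>) c"
      using fourier_negative_integer_power[OF f, of j] unfolding \<gamma>_def by blast
    have \<alpha>: "\<alpha> = - real (Suc j)" "- \<alpha> - 1 = real j" using m j by auto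
    have "fourier_dist ?T \<phi> = c"
      using c(1) cis_pi_times_nat(1)[of "Suc j"]
      by (intro fourier_dist_Pf_power f) (simp only: \<alpha> mult_minus_right minus_minus)
    \<comment> \<open>The exponent j is nonnegative, so on this side the finite part is an ordinary
      integral.\<close>
    also have "c = two_sided \<gamma> ((-1) ^ Suc j * \<gamma>) (real j) \<phi> 0"
      by (rule has_finite_part_unique[OF c(2)]) (intro has_finite_part_tendsto two_sided_tendsto f, simp)
    also have "\<dots> = integral {x. 0 < \<bar>x\<bar>} (\<lambda>x. ?g x * \<phi> x)"
    proof (rule integral_homogeneous_eq_two_sided[OF f, symmetric])
      fix x :: real assume x: "x > 0"
      show "?g x = \<gamma> * complex_of_real (x powr real j)"
        unfolding \<alpha>(2) pcpow_of_real[OF x] unfolding \<alpha>(1) pcpow_i_nat using x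
        by (simp add: \<gamma>_def j)
      show "?g (- x) = (-1) ^ Suc j * \<gamma> * complex_of_real (x powr real j)"
        unfolding \<alpha>(2) pcpow_of_real[OF x] cis_pi_times_nat unfolding \<alpha>(1) pcpow_i_nat using x
        by (simp add: \<gamma>_def j)
    qed simp
    also have "\<dots> = integral UNIV (\<lambda>x. if x \<in> {x. 0 < \<bar>x\<bar>} then ?g x * \<phi> x else 0)"
      by (rule integral_restrict_UNIV[symmetric])
    \<comment> \<open>The excluded origin contributes nothing even pointwise, because
      \<open>sgn 0 = 0\<close>.\<close>
    also have "(\<lambda>x. if x \<in> {x. 0 < \<bar>x\<bar>} then ?g x * \<phi> x else 0) = (\<lambda>x. ?g x * \<phi> x)"
      by auto
    finally show "fourier_dist ?T \<phi> = regular_dist ?g \<phi>" unfolding regular_dist_def .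
  next
    assume \<alpha>: "\<alpha> \<notin> \<int>"
    let ?G = "complex_of_real (Gamma (\<alpha> + 1))"
    let ?p = "cis (pi / 2 * (\<alpha> + 1))" and ?q = "cis (- (pi / 2 * (\<alpha> + 1)))"
    have "\<alpha> + 1 \<notin> \<int>" using \<alpha> Ints_diff[of "\<alpha> + 1" 1] by auto
    then have "\<alpha> + 1 \<notin> \<int>\<^sub>\<le>\<^sub>0" using nonpos_Ints_Int by auto
    then have G: "?G \<noteq> 0" by (simp add: Gamma_eq_zero_iff)
    \<comment> \<open>The pairs (1, 0) and (0, 1) treat x_+^\<alpha> and x_-^\<alpha> separately:
      divided by \<Gamma>(\<alpha>+1), their transforms are exactly 1/(ix)^(\<alpha>+1) and
      1/(-ix)^(\<alpha>+1).\<close>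
    obtain c where c: "has_finite_part (two_sided 1 0 \<alpha> (fourier \<phi>)) c"
      "has_finite_part (two_sided (fourier_coeff \<alpha> 1 0) (fourier_coeff \<alpha> 0 1) (- \<alpha> - 1) \<phi>) c"
      using fourier_power_rule_not_Ints[OF \<alpha>] f by (rule fourier_power_ruleE)
    obtain d where d: "has_finite_part (two_sided 0 1 \<alpha> (fourier \<phi>)) d"
      "has_finite_part (two_sided (fourier_coeff \<alpha> 0 1) (fourier_coeff \<alpha> 1 0) (- \<alpha> - 1) \<phi>) d"
      using fourier_power_rule_not_Ints[OF \<alpha>] f by (rule fourier_power_ruleE)
    have T: "fourier_dist ?T \<phi> = 1 * c + cis (- (pi * \<alpha>)) * d"
      by (intro fourier_dist_Pf_power f has_finite_part_two_sided_combine c d)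
    have coeff: "fourier_coeff \<alpha> 1 0 = ?G * ?q" "fourier_coeff \<alpha> 0 1 = ?G * ?p"
      by (simp_all add: fourier_coeff_def)
    have inv: "1 / (?q * complex_of_real (x powr (\<alpha> + 1))) = ?p * complex_of_real (x powr (- \<alpha> - 1))"
      "1 / (?p * complex_of_real (x powr (\<alpha> + 1))) = ?q * complex_of_real (x powr (- \<alpha> - 1))" for x :: real
    proof -
      have p: "x powr (- \<alpha> - 1) = inverse (x powr (\<alpha> + 1))"
        using powr_minus[of x "\<alpha> + 1"] by simp
      show "1 / (?q * complex_of_real (x powr (\<alpha> + 1))) = ?p * complex_of_real (x powr (- \<alpha> - 1))"
        "1 / (?p * complex_of_real (x powr (\<alpha> + 1))) = ?q * complex_of_real (x powr (- \<alpha> - 1))"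
        unfolding p inverse_cis_times by (simp_all only: minus_minus)
    qed
    have cancel: "1 / ?G * (?G * w) = w" for w using G by simp
    have pf1: "Pf (\<lambda>x. 1 / pcpow (- \<i> * complex_of_real x) (complex_of_real (\<alpha> + 1))) \<phi> = d / ?G"
    proof (rule Pf_homogeneous[OF f])
      show "has_finite_part (two_sided ?p ?q (- \<alpha> - 1) \<phi>) (d / ?G)"
        by (rule has_finite_part_two_sided_scale[OF d(2), where z = "1 / ?G"]) (unfold coeff cancel, simp_all)
      fix x :: real assume x: "x > 0"
      show "1 / pcpow (- \<i> * complex_of_real x) (complex_of_real (\<alpha> + 1)) = ?p * complex_of_real (x powr (- \<alpha> - 1))"
        unfolding mult_minus_left pcpow_i_times_of_real[OF x] by (rule inv)
      show "1 / pcpow (- \<i> * complex_of_real (- x)) (complex_of_real (\<alpha> + 1)) = ?q * complex_of_real (x powr (- \<alpha> - 1))"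
        unfolding of_real_minus minus_mult_minus pcpow_i_times_of_real[OF x] by (rule inv)
    qed
    have pf2: "Pf (\<lambda>x. 1 / pcpow (\<i> * complex_of_real x) (complex_of_real (\<alpha> + 1))) \<phi> = c / ?G"
    proof (rule Pf_homogeneous[OF f])
      show "has_finite_part (two_sided ?q ?p (- \<alpha> - 1) \<phi>) (c / ?G)"
        by (rule has_finite_part_two_sided_scale[OF c(2), where z = "1 / ?G"]) (unfold coeff cancel, simp_all)
      fix x :: real assume x: "x > 0"
      show "1 / pcpow (\<i> * complex_of_real x) (complex_of_real (\<alpha> + 1)) = ?q * complex_of_real (x powr (- \<alpha> - 1))"
        unfolding pcpow_i_times_of_real[OF x] by (rule inv)
      show "1 / pcpow (\<i> * complex_of_real (- x)) (complex_of_real (\<alpha> + 1)) = ?p * complex_of_real (x powr (- \<alpha> - 1))"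
        unfolding of_real_minus mult_minus_right pcpow_i_times_of_real[OF x] by (rule inv)
    qed
    have ex: "exp (- \<i> * complex_of_real (pi * \<alpha>)) = cis (- (pi * \<alpha>))"
      by (simp add: cis_conv_exp)
    show "fourier_dist ?T \<phi> = ?G *
                 (exp (- \<i> * complex_of_real (pi * \<alpha>))
                    * Pf (\<lambda>x. 1 / pcpow (- \<i> * complex_of_real x) (complex_of_real (\<alpha> + 1))) \<phi>
                  + Pf (\<lambda>x. 1 / pcpow (\<i> * complex_of_real x) (complex_of_real (\<alpha> + 1))) \<phi>)"
      unfolding T pf1 pf2 ex using G by (simp add: distrib_left)
  }
qed

end
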